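(* Let $f:\mathbb{R}^d\to\mathbb{R}$ be twice continuously differentiable and bounded from below, and let $f$ satisfy the local PL condition at a local minimizer $x_*$ of $f$. Let $L$ and $\mu$ denote, respectively, the largest and the smallest nonzero eigenvalue of $\nabla^2 f(x_* )$, and let $\mathcal{S}:=\{x\in\mathbb{R}^d: x\text{ is a local minimizer of } f \text{ and } f(x)=f(x_* )\}$. Then, for every sufficiently small $\varepsilon>0$, there exists a sufficiently small open neighborhood $U\subset\mathbb{R}^d$ of $x_*$ such that for any $x^0,x^1\in U$, the sequence $\{x^n\}_{n\in\mathbb{N}}$ generated by NAG converges linearly to a local minimizer $x_*'\in\mathcal{S}$, i.e., $$\|x^n-x_*'\|\le C_\varepsilon\big(\|x^1-x_*'\|+\|x^0-x_*'\|\big)(\rho_{\alpha,\beta}+\varepsilon)^n\quad\text{for all } n\ge1,$$ for the step size $\alpha$ satisfying $$\alpha\in\left(0,\frac{2(\beta+1)}{(L+\varepsilon)(2\beta+1)}\right),\quad\text{for all }\beta\in[0,1),$$ where $\rho_{\alpha,\beta}\in(0,1)$ is a contraction factor depending on $\alpha$ and $\beta$, and $C_\varepsilon>0$ is a constant depending on $\varepsilon$. Here $U$ is chosen after $\varepsilon$, and the condition on $\alpha,\beta$ is imposed afterwards. In particular, with the optimal parameter choice $$\alpha_{\mathrm{opt}}=\frac{4}{3L+\mu}\quad\text{and}\quad \beta_{\mathrm{opt}}=\frac{\sqrt{3L+\mu}-2\sqrt{\mu}}{\sqrt{3L+\mu}+2\sqrt{\mu}},$$ NAG achieves the optimal linear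 convergence rate $$\|x^n-x_*'\|\le C_\varepsilon\big(\|x^1-x_*'\|+\|x^0-x_*'\|\big)\left(\frac{\sqrt{3L+\mu}-2\sqrt{\mu}}{\sqrt{3L+\mu}}+\varepsilon\right)^n\quad\text{for all } n\ge1.$$
   Context: $\|\cdot\|$ is the Euclidean norm. NAG (Nesterov's accelerated gradient method) with step size $\alpha>0$ and momentum parameter $\beta\in[0,1)$: given $x^0,x^1\in\mathbb{R}^d$, for $n\ge1$ set $v_n:=x^n-x^{n-1}$, $y^n:=x^n+\beta v_n$, $x^{n+1}:=y^n-\alpha\nabla f(y^n)$. Local PL condition: a $C^2$ function $f$ satisfies the local PL (Polyak–Łojasiewicz) condition at a local minimizer $x_*$ if there exist a sufficiently small open neighborhood $V$ of $x_*$ and a constant $\nu>0$ such that $\|\nabla f(x)\|^2\ge 2\nu\,(f(x)-f(x_* ))$ for all $x\in V$. Standing assumption: the trivial case in which $f$ is constant in a neighborhood of $x_*$ is excluded. Equivalently, the set $\mathcal{S}$, which under the local PL condition is near $x_*$ a $C^1$ embedded submanifold with tangent space $\ker\nabla^2 f$ at each of its points, has dimension $<d$ near $x_*$. In particular $\nabla^2 f(x_* )$ is positive semidefinite and nonzero, so $0<\mu\le L$. "Optimal" refers to matching, up to $\varepsilon$, the optimal contraction factor of NAG (with optimally tuned $\alpha,\beta$) for strongly convex quadratic problems with extreme Hessian eigenvalues $\mu$ and $L$.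
   Formalization: For general α, β the formal bound is claimed only when ρ_{α,β}+ε<1; with U chosen before α, β the unrestricted claim is false (tilted double well, α→0, β→1). Every fixed admissible pair is covered for small enough ε. *)

theory Defs
  imports "HOL-Analysis.Analysis"
begin

definition gradient :: "('a::real_inner \<Rightarrow> real) \<Rightarrow> 'a \<Rightarrow> 'a" where
  "gradient f x = (THE D. GDERIV f x :> D)"

definition hessian :: "(real ^ 'n \<Rightarrow> real) \<Rightarrow> real ^ 'n \<Rightarrow> real ^ 'n ^ 'n" where
  "hessian f x = jacobian (gradient f) (at x)"

definition twice_continuously_differentiable :: "(real ^ 'n \<Rightarrow> real) \<Rightarrow> bool" where
  "twice_continuously_differentiable f \<longleftrightarrow>
     (\<forall>x. f differentiable (at x)) \<and> (\<forall>x. gradient f differentiable (at x)) \<and>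
     continuous_on UNIV (hessian f)"

definition eigenvalues :: "real ^ 'n ^ 'n \<Rightarrow> real set" where
  "eigenvalues A = {c. \<exists>v. v \<noteq> 0 \<and> A *v v = c *\<^sub>R v}"

definition local_minimizer :: "('a::topological_space \<Rightarrow> real) \<Rightarrow> 'a \<Rightarrow> bool" where
  "local_minimizer f x \<longleftrightarrow> (\<exists>V. open V \<and> x \<in> V \<and> (\<forall>y\<in>V. f x \<le> f y))"

definition local_PL :: "('a::real_inner \<Rightarrow> real) \<Rightarrow> 'a \<Rightarrow> bool" where
  "local_PL f x \<longleftrightarrow>
     (\<exists>V \<nu>. open V \<and> x \<in> V \<and> \<nu> > 0 \<and>
        (\<forall>y\<in>V. (norm (gradient f y))\<^sup>2 \<ge> 2 * \<nu> * (f y - f x)))"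

fun nag :: "('a::real_inner \<Rightarrow> real) \<Rightarrow> real \<Rightarrow> real \<Rightarrow> 'a \<Rightarrow> 'a \<Rightarrow> nat \<Rightarrow> 'a" where
  "nag f \<alpha> \<beta> x0 x1 0 = x0"
| "nag f \<alpha> \<beta> x0 x1 (Suc 0) = x1"
| "nag f \<alpha> \<beta> x0 x1 (Suc (Suc n)) =
     (let v = nag f \<alpha> \<beta> x0 x1 (Suc n) - nag f \<alpha> \<beta> x0 x1 n;
          y = nag f \<alpha> \<beta> x0 x1 (Suc n) + \<beta> *\<^sub>R v
      in y - \<alpha> *\<^sub>R gradient f y)"

definition linear_bound :: "(nat \<Rightarrow> 'a::real_normed_vector) \<Rightarrow> 'a \<Rightarrow> real \<Rightarrow> real \<Rightarrow> bool" where
  "linear_bound x z C r \<longleftrightarrow>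
     (\<forall>n\<ge>1. norm (x n - z) \<le> C * (norm (x 1 - z) + norm (x 0 - z)) * r ^ n)"

definition quadratic_problems :: "real \<Rightarrow> real \<Rightarrow> (real ^ 'n \<Rightarrow> real) set" where
  "quadratic_problems \<mu> L =
     {\<lambda>x. 1/2 * (x \<bullet> (A *v x)) + b \<bullet> x + c | A b c.
        transpose A = A \<and> 0 < \<mu> \<and> Min (eigenvalues A) = \<mu> \<and> Max (eigenvalues A) = L}"

text \<open>\<open>r\<close> is, up to arbitrarily small \<open>\<epsilon>\<close>, a global linear rate of NAG with parameters \<open>\<alpha>, \<beta>\<close>
  on every problem of the class \<open>Q\<close>. For quadratic problems the smallest such \<open>r\<close> is the spectral
  radius of the (linear) NAG iteration; the slack \<open>\<epsilon>\<close> absorbs non-trivial Jordan blocks, which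
  do occur at the optimal parameters.\<close>

definition nag_contraction_factor ::
    "('a::real_inner \<Rightarrow> real) set \<Rightarrow> real \<Rightarrow> real \<Rightarrow> real \<Rightarrow> bool" where
  "nag_contraction_factor Q \<alpha> \<beta> r \<longleftrightarrow> 0 \<le> r \<and>
     (\<forall>q\<in>Q. \<forall>\<epsilon>>0. \<exists>C>0. \<forall>x0 x1 z. (\<forall>y. q z \<le> q y) \<longrightarrow>
        linear_bound (nag q \<alpha> \<beta> x0 x1) z C (r + \<epsilon>))"

definition optimal_nag_contraction_factor ::
    "('a::real_inner \<Rightarrow> real) set \<Rightarrow> real \<Rightarrow> real \<Rightarrow> real \<Rightarrow> bool" where
  "optimal_nag_contraction_factor Q \<alpha> \<beta> r \<longleftrightarrow>
     \<alpha> > 0 \<and> \<beta> \<in> {0..<1} \<and> nag_contraction_factor Q \<alpha> \<beta> r \<and>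
     (\<forall>\<alpha>'>0. \<forall>\<beta>'\<in>{0..<1}. \<forall>r'. nag_contraction_factor Q \<alpha>' \<beta>' r' \<longrightarrow> r \<le> r')"

end

theory Submission
  imports Defs
begin

text \<open>
  The proof avoids describing the set of minimisers as a manifold. Instead of distances to this set
  it follows the pair \<open>(v\<^sub>n, g\<^sub>n)\<close> of the increment \<open>v\<^sub>n = x\<^sub>n - x\<^sub>n\<^sub>-\<^sub>1\<close> and the gradient
  \<open>g\<^sub>n = \<nabla>f (y\<^sub>n)\<close> at the extrapolated point. One NAG step gives exactly
  \<open>v\<^sub>n\<^sub>+\<^sub>1 = \<beta> v\<^sub>n - \<alpha> g\<^sub>n\<close>, and, since the gradient is strictly differentiable at \<open>x\<^sub>*\<close> with derivative
  \<open>H = \<nabla>\<^sup>2f (x\<^sub>*)\<close>, up to a small relative error \<open>g\<^sub>n\<^sub>+\<^sub>1 = g\<^sub>n + H ((1 + \<beta>) v\<^sub>n\<^sub>+\<^sub>1 - \<beta> v\<^sub>n)\<close>.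

  The PL condition enters through an error bound (\<open>PL_error_bound\<close>): near \<open>x\<^sub>*\<close> the distance of \<open>x\<close> to
  some critical point with the value \<open>f x\<^sub>*\<close> is at most a multiple of \<open>\<bar>\<nabla>f x\<bar>\<close>. It follows that the
  component of \<open>\<nabla>f x\<close> in the kernel of \<open>H\<close> is small compared with the whole gradient
  (\<open>gradient_kernel_component_small\<close>), so it too can be treated as a perturbation. What remains is a
  linear operator that splits along an orthonormal eigenbasis of \<open>H\<close>: on the kernel the increment is
  multiplied by \<open>\<beta>\<close>, and on an eigenvector with eigenvalue \<open>\<lambda> \<in> [\<mu>, L]\<close> both components satisfy the
  two-term recurrence with characteristic polynomial \<open>t\<^sup>2 - (1 + \<beta>) (1 - \<alpha> \<lambda>) t + \<beta> (1 - \<alpha> \<lambda>)\<close>. Hence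
  the linear rate is the maximum \<open>nag_rate\<close> of \<open>\<beta>\<close> and the largest moduli of the roots for
  \<open>\<lambda> = \<mu>\<close> and \<open>\<lambda> = L\<close>; the eigenvalues in between are covered by convexity of the Schur--Jury test
  for the roots.

  The powers of the operator are bounded by a constant times the power of any slightly larger rate,
  with a constant that depends on the margin only (\<open>recurrence_bound\<close>). This makes the neighbourhood
  and the constant of the local convergence theorem \<open>nag_local_linear_convergence\<close> independent of
  \<open>\<alpha>\<close> and \<open>\<beta>\<close>. Geometric decay of the increments keeps the iterates near \<open>x\<^sub>*\<close> and makes them
  converge; the limit is a critical point and, by the PL condition, a minimiser.

  For strongly convex quadratic problems the same recurrences describe the iteration exactly, so a
  contraction factor must dominate the radii for \<open>\<mu>\<close> and \<open>L\<close>. That no choice of parameters makes both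
  radii smaller than the stated rate is the polynomial inequality of \<open>squared_rate_gap_le\<close>.
\<close>

section \<open>Orthonormal eigenbases of symmetric operators\<close>

locale eigenbasis =
  fixes T :: "'a::euclidean_space \<Rightarrow> 'a" and B :: "'a set" and ev :: "'a \<Rightarrow> real"
  assumes linear: "linear T"
    and self_adjoint: "T x \<bullet> y = x \<bullet> T y"
    and finite: "finite B"
    and orthonormal: "\<lbrakk>b \<in> B; c \<in> B\<rbrakk> \<Longrightarrow> b \<bullet> c = (if b = c then 1 else 0)"
    and complete: "(\<And>b. b \<in> B \<Longrightarrow> x \<bullet> b = 0) \<Longrightarrow> x = 0"
    and eigenvector: "b \<in> B \<Longrightarrow> T b = ev b *\<^sub>R b"
begin

lemma norm_basis: "b \<in> B \<Longrightarrow> norm b = 1"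
  by (simp add: norm_eq_sqrt_inner orthonormal)

lemma coord_le_norm: "b \<in> B \<Longrightarrow> \<bar>x \<bullet> b\<bar> \<le> norm x"
  using Cauchy_Schwarz_ineq2[of x b] by (simp add: norm_basis)

lemma coord_T: "b \<in> B \<Longrightarrow> T x \<bullet> b = ev b * (x \<bullet> b)"
  by (simp add: self_adjoint eigenvector)

lemma coord_sum: "c \<in> B \<Longrightarrow> (\<Sum>b\<in>B. f b *\<^sub>R b) \<bullet> c = f c"
  by (simp add: inner_sum_left orthonormal if_distrib finite cong: if_cong)

lemma expansion: "x = (\<Sum>b\<in>B. (x \<bullet> b) *\<^sub>R b)"
proof -
  have "x - (\<Sum>b\<in>B. (x \<bullet> b) *\<^sub>R b) = 0"
    by (rule complete) (simp add: inner_diff_left coord_sum)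
  then show ?thesis by simp
qed

lemma norm_le_sum_coord: "norm x \<le> (\<Sum>b\<in>B. \<bar>x \<bullet> b\<bar>)"
proof -
  have "norm x = norm (\<Sum>b\<in>B. (x \<bullet> b) *\<^sub>R b)"
    using expansion[of x] by simp
  also have "\<dots> \<le> (\<Sum>b\<in>B. norm ((x \<bullet> b) *\<^sub>R b))"
    by (rule norm_sum)
  also have "\<dots> = (\<Sum>b\<in>B. \<bar>x \<bullet> b\<bar>)"
    by (simp add: norm_basis)
  finally show ?thesis .
qed

lemma eq_if_coords_eq: "(\<And>b. b \<in> B \<Longrightarrow> x \<bullet> b = y \<bullet> b) \<Longrightarrow> x = y"
  using complete[of "x - y"] by (simp add: inner_diff_left)

lemma quadratic_form: "x \<bullet> T x = (\<Sum>b\<in>B. ev b * (x \<bullet> b)\<^sup>2)"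
proof -
  have "x \<bullet> T x = (\<Sum>b\<in>B. (x \<bullet> b) *\<^sub>R b) \<bullet> T x"
    using expansion[of x] by simp
  also have "\<dots> = (\<Sum>b\<in>B. ev b * (x \<bullet> b)\<^sup>2)"
    unfolding inner_sum_left
    by (rule sum.cong) (use coord_T[of _ x] in \<open>auto simp: power2_eq_square inner_commute\<close>)
  finally show ?thesis .
qed

lemma eigenvalue_iff: "(\<exists>v. v \<noteq> 0 \<and> T v = c *\<^sub>R v) \<longleftrightarrow> c \<in> ev ` B"
proof
  assume "\<exists>v. v \<noteq> 0 \<and> T v = c *\<^sub>R v"
  then obtain v where v: "v \<noteq> 0" "T v = c *\<^sub>R v" by blast
  then obtain b where b: "b \<in> B" "v \<bullet> b \<noteq> 0" using complete by blast
  have "c * (v \<bullet> b) = ev b * (v \<bullet> b)"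
    using coord_T[OF b(1), of v] v(2) by simp
  then show "c \<in> ev ` B" using b by auto
next
  assume "c \<in> ev ` B"
  then obtain b where b: "b \<in> B" "c = ev b" by blast
  moreover have "b \<noteq> 0" using norm_basis[OF b(1)] by auto
  ultimately show "\<exists>v. v \<noteq> 0 \<and> T v = c *\<^sub>R v" using eigenvector by blast
qed

end

text \<open>A maximiser of the Rayleigh quotient over an invariant subspace is an eigenvector: the
  form \<open>M \<bar>w\<bar>\<^sup>2 - w \<bullet> T w\<close> is nonnegative on the subspace and vanishes at the maximiser, so its
  first variation vanishes there.\<close>

lemma eigenvector_in_invariant_subspace:
  fixes T :: "'a::euclidean_space \<Rightarrow> 'a"
  assumes lin: "linear T" and sa: "\<And>x y. T x \<bullet> y = x \<bullet> T y"
    and W: "subspace W" and inv: "T ` W \<subseteq> W" and ne: "w0 \<in> W" "w0 \<noteq> 0"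
  obtains e c where "e \<in> W" "norm e = 1" "T e = c *\<^sub>R e"
proof -
  interpret linear T by fact
  define K where "K = sphere 0 1 \<inter> W"
  have "compact K" unfolding K_def
    by (intro compact_Int_closed) (auto simp: closed_subspace W)
  moreover have "(1 / norm w0) *\<^sub>R w0 \<in> K"
    using ne W by (auto simp: K_def subspace_scale)
  then have "K \<noteq> {}" by blast
  moreover have "continuous_on K (\<lambda>x. x \<bullet> T x)"
    by (intro continuous_intros linear_continuous_on linear_conv_bounded_linear[THEN iffD1] lin)
  ultimately obtain e where e: "e \<in> K" and max: "\<And>x. x \<in> K \<Longrightarrow> x \<bullet> T x \<le> e \<bullet> T e"
    using continuous_attains_sup[of K "\<lambda>x. x \<bullet> T x"] by blast
  define M where "M = e \<bullet> T e"
  define F where "F w = M * (w \<bullet> w) - w \<bullet> T w" for w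
  have eW: "e \<in> W" and e1: "norm e = 1" using e by (auto simp: K_def)
  have ee: "e \<bullet> e = 1" using e1 by (simp add: norm_eq_1)
  have F_nonneg: "F w \<ge> 0" if "w \<in> W" for w
  proof (cases "w = 0")
    case False
    define u where "u = (1 / norm w) *\<^sub>R w"
    have "u \<in> K" using that False W by (auto simp: K_def u_def subspace_scale)
    then have "u \<bullet> T u \<le> M" unfolding M_def by (rule max)
    moreover have "w = norm w *\<^sub>R u" using False by (simp add: u_def)
    then have "w \<bullet> T w = (norm w)\<^sup>2 * (u \<bullet> T u)"
      by (metis inner_scaleR_left inner_scaleR_right scale mult.assoc power2_eq_square)
    ultimately show ?thesis
      unfolding F_def by (simp add: dot_square_norm mult.commute[of M] mult_left_mono)
  qed (simp add: F_def)
  define d where "d = M *\<^sub>R e - T e"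
  have dW: "d \<in> W" unfolding d_def using W eW inv by (auto intro!: subspace_diff subspace_scale)
  have F_line: "F (e - t *\<^sub>R d) = - 2 * t * (d \<bullet> d) + t\<^sup>2 * F d" for t
  proof -
    have "T e \<bullet> d = e \<bullet> T d" "d \<bullet> T e = e \<bullet> T d" using sa by (auto simp: inner_commute)
    moreover have "d \<bullet> d = M * (e \<bullet> d) - T e \<bullet> d"
      by (simp add: d_def inner_diff_left)
    moreover have "F (e - t *\<^sub>R d)
        = M * (1 - 2 * t * (e \<bullet> d) + t\<^sup>2 * (d \<bullet> d)) - (M - t * (e \<bullet> T d) - t * (d \<bullet> T e) + t\<^sup>2 * (d \<bullet> T d))"
      by (simp add: F_def diff scale inner_diff_left inner_diff_right ee M_def[symmetric]
          inner_commute[of d e] power2_eq_square algebra_simps)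
    ultimately show ?thesis
      unfolding F_def[of d] by (simp only:) (simp add: algebra_simps)
  qed
  have "d \<bullet> d = 0"
  proof (rule ccontr)
    assume "d \<bullet> d \<noteq> 0"
    then have pos: "d \<bullet> d > 0" by (simp add: inner_gt_zero_iff)
    have le: "2 * (d \<bullet> d) \<le> t * F d" if "t > 0" for t
    proof -
      have "0 \<le> F (e - t *\<^sub>R d)" using W eW dW by (intro F_nonneg subspace_diff subspace_scale)
      then have "t * (2 * (d \<bullet> d)) \<le> t * (t * F d)"
        unfolding F_line by (simp add: power2_eq_square algebra_simps)
      then show ?thesis using that by simp
    qed
    have "F d \<ge> 0" using F_nonneg dW by blast
    then have "2 * (d \<bullet> d) \<le> (d \<bullet> d) / (F d + 1) * F d"
      using pos by (intro le) simp
    moreover have "(d \<bullet> d) / (F d + 1) * F d \<le> d \<bullet> d"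
      using pos \<open>F d \<ge> 0\<close> by (simp add: field_simps)
    ultimately have "2 * (d \<bullet> d) \<le> d \<bullet> d" by linarith
    with pos show False by simp
  qed
  then have "T e = M *\<^sub>R e" by (simp add: d_def)
  with eW e1 show ?thesis by (rule that)
qed

text \<open>The spectral theorem: in a largest orthonormal set of eigenvectors nothing is orthogonal
  to all members, since the orthogonal complement is invariant and would contain one more.\<close>

theorem eigenbasis_exists:
  fixes T :: "'a::euclidean_space \<Rightarrow> 'a"
  assumes lin: "linear T" and sa: "\<And>x y. T x \<bullet> y = x \<bullet> T y"
  obtains B ev where "eigenbasis T B ev"
proof -
  define good where "good B \<longleftrightarrow> (\<forall>b\<in>B. \<forall>c\<in>B. b \<bullet> c = (if b = c then 1 else 0)) \<and>
      (\<forall>b\<in>B. \<exists>c. T b = c *\<^sub>R b)" for B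
  have fin: "finite B \<and> card B \<le> DIM('a)" if "good B" for B
  proof -
    have "pairwise orthogonal B" "0 \<notin> B"
      using that unfolding good_def pairwise_def orthogonal_def by force+
    then have "independent B" by (rule pairwise_orthogonal_independent)
    then show ?thesis using independent_bound by blast
  qed
  have "good {}" by (simp add: good_def)
  then obtain B where B: "good B" and max: "\<And>B'. good B' \<Longrightarrow> card B' \<le> card B"
    using fin ex_has_greatest_nat[of good "{}" card "Suc DIM('a)"]
    by (auto simp: less_Suc_eq_le)
  have "\<forall>b\<in>B. \<exists>c. T b = c *\<^sub>R b" using B by (simp add: good_def)
  then obtain ev where ev: "\<And>b. b \<in> B \<Longrightarrow> T b = ev b *\<^sub>R b" by metis
  have on: "b \<bullet> c = (if b = c then 1 else 0)" if "b \<in> B" "c \<in> B" for b c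
    using B that by (simp add: good_def)
  have compl: "x = 0" if x: "\<And>b. b \<in> B \<Longrightarrow> x \<bullet> b = 0" for x
  proof (rule ccontr)
    assume "x \<noteq> 0"
    define W where "W = {w. \<forall>b\<in>B. w \<bullet> b = 0}"
    have "subspace W" by (auto simp: W_def subspace_def inner_add_left)
    moreover have "T ` W \<subseteq> W" by (auto simp: W_def sa ev)
    moreover have "x \<in> W" using x by (simp add: W_def)
    ultimately obtain e c where e: "e \<in> W" "norm e = 1" "T e = c *\<^sub>R e"
      using eigenvector_in_invariant_subspace[OF lin sa] \<open>x \<noteq> 0\<close> by metis
    have ee: "e \<bullet> e = 1" using e(2) by (simp add: norm_eq_1)
    have eb: "e \<bullet> b = 0" "b \<bullet> e = 0" if "b \<in> B" for b
      using e(1) that by (auto simp: W_def inner_commute)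
    have "e \<notin> B" using eb(1)[of e] ee by auto
    have "good (insert e B)"
      using B ee eb e(3) \<open>e \<notin> B\<close> unfolding good_def by auto
    then show False using max[of "insert e B"] fin[OF B] \<open>e \<notin> B\<close> by simp
  qed
  have "eigenbasis T B ev"
    by (rule eigenbasis.intro[OF lin sa conjunct1[OF fin[OF B]] on compl ev])
  then show ?thesis by (rule that)
qed

section \<open>Two-term recurrences\<close>

text \<open>The largest modulus of a root of \<open>t\<^sup>2 - a t + b\<close>.\<close>

definition root_radius :: "real \<Rightarrow> real \<Rightarrow> real" where
  "root_radius a b = (if 4 * b \<le> a\<^sup>2 then (\<bar>a\<bar> + sqrt (a\<^sup>2 - 4 * b)) / 2 else sqrt b)"

lemma root_radius_nonneg: "0 \<le> root_radius a b"
proof -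
  have "0 \<le> b" if "\<not> 4 * b \<le> a\<^sup>2" using that zero_le_power2[of a] by linarith
  then show ?thesis by (auto simp: root_radius_def)
qed

lemma real_root_radius_le_iff:
  fixes a b R :: real
  assumes disc: "4 * b \<le> a\<^sup>2"
  shows "\<bar>a\<bar> + sqrt (a\<^sup>2 - 4 * b) \<le> 2 * R \<longleftrightarrow> \<bar>a\<bar> \<le> 2 * R \<and> \<bar>a\<bar> * R \<le> R\<^sup>2 + b"
proof -
  have eq: "(2 * R - \<bar>a\<bar>)\<^sup>2 = 4 * R\<^sup>2 - 4 * (\<bar>a\<bar> * R) + a\<^sup>2"
    by (simp add: power2_diff power_mult_distrib)
  have "sqrt (a\<^sup>2 - 4 * b) \<le> 2 * R - \<bar>a\<bar> \<longleftrightarrow> 0 \<le> 2 * R - \<bar>a\<bar> \<and> a\<^sup>2 - 4 * b \<le> (2 * R - \<bar>a\<bar>)\<^sup>2"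
    (is "?s \<le> ?y \<longleftrightarrow> _")
  proof (intro iffI conjI)
    assume le: "?s \<le> ?y"
    then show "0 \<le> ?y" using disc real_sqrt_ge_zero[of "a\<^sup>2 - 4 * b"] by linarith
    show "a\<^sup>2 - 4 * b \<le> ?y\<^sup>2" using le by (rule sqrt_le_D)
  qed (auto intro: real_le_lsqrt)
  also have "a\<^sup>2 - 4 * b \<le> (2 * R - \<bar>a\<bar>)\<^sup>2 \<longleftrightarrow> \<bar>a\<bar> * R \<le> R\<^sup>2 + b"
    using eq by auto
  finally show ?thesis by linarith
qed

text \<open>The Schur--Jury test. It replaces the roots by inequalities which, for the NAG coefficients, are
  convex in the eigenvalue.\<close>

lemma root_radius_le_iff:
  assumes R: "0 \<le> R"
  shows "root_radius a b \<le> R \<longleftrightarrow> \<bar>b\<bar> \<le> R\<^sup>2 \<and> \<bar>a\<bar> \<le> 2 * R \<and> \<bar>a\<bar> * R \<le> R\<^sup>2 + b"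
proof (cases "4 * b \<le> a\<^sup>2")
  case True
  have "\<bar>b\<bar> \<le> R\<^sup>2" if "\<bar>a\<bar> \<le> 2 * R" "\<bar>a\<bar> * R \<le> R\<^sup>2 + b"
  proof -
    have "a\<^sup>2 \<le> (2 * R)\<^sup>2" using that(1) abs_le_square_iff[of a "2 * R"] R by simp
    then have "b \<le> R\<^sup>2" using True by (simp add: power_mult_distrib)
    moreover have "- R\<^sup>2 \<le> b" using that(2) mult_nonneg_nonneg[OF abs_ge_zero R, of a] by linarith
    ultimately show ?thesis by simp
  qed
  then show ?thesis
    using real_root_radius_le_iff[OF True, of R] True unfolding root_radius_def by auto
next
  case False
  then have b: "0 \<le> b" using zero_le_power2[of a] by linarith
  have *: "\<bar>a\<bar> \<le> 2 * R" "\<bar>a\<bar> * R \<le> R\<^sup>2 + b" if "b \<le> R\<^sup>2"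
  proof -
    have "a\<^sup>2 \<le> (2 * R)\<^sup>2" using False that by (simp add: power_mult_distrib)
    then show "\<bar>a\<bar> \<le> 2 * R" using abs_le_square_iff[of a "2 * R"] R by simp
    have "0 \<le> (R - \<bar>a\<bar> / 2)\<^sup>2" by simp
    then have "\<bar>a\<bar> * R \<le> R\<^sup>2 + a\<^sup>2 / 4" by (simp add: power2_diff power_divide mult.commute)
    then show "\<bar>a\<bar> * R \<le> R\<^sup>2 + b" using False by linarith
  qed
  have "sqrt b \<le> R \<longleftrightarrow> b \<le> R\<^sup>2" using R by (auto intro: sqrt_le_D real_le_lsqrt)
  then show ?thesis using False b * unfolding root_radius_def by auto
qed

lemma root_radius_less_one:
  assumes "b < 1" "\<bar>a\<bar> < 2" "\<bar>a\<bar> < 1 + b"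
  shows "root_radius a b < 1"
proof (cases "4 * b \<le> a\<^sup>2")
  case True
  have "a\<^sup>2 - 4 * b < (2 - \<bar>a\<bar>)\<^sup>2" using assms(3) by (simp add: power2_diff)
  then have "sqrt (a\<^sup>2 - 4 * b) < 2 - \<bar>a\<bar>" using assms(2) by (intro real_less_lsqrt) auto
  then show ?thesis using True by (simp add: root_radius_def)
next
  case False
  then show ?thesis using assms by (simp add: root_radius_def)
qed

lemma quadratic_roots_in_disc:
  obtains r s :: complex where "r + s = of_real a" "r * s = of_real b"
    "cmod r \<le> root_radius a b" "cmod s \<le> root_radius a b"
proof (cases "4 * b \<le> a\<^sup>2")
  case True
  define d where "d = sqrt (a\<^sup>2 - 4 * b)"
  have d: "0 \<le> d" "d\<^sup>2 = a\<^sup>2 - 4 * b" using True by (auto simp: d_def)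
  show ?thesis
  proof (rule that[of "of_real ((a + d) / 2)" "of_real ((a - d) / 2)"])
    show "complex_of_real ((a + d) / 2) * of_real ((a - d) / 2) = of_real b"
      unfolding of_real_mult[symmetric] of_real_eq_iff using d
      by (simp add: field_simps power2_eq_square)
    show "complex_of_real ((a + d) / 2) + of_real ((a - d) / 2) = of_real a"
      unfolding of_real_add[symmetric] of_real_eq_iff by (simp add: field_simps)
  qed (use True d in \<open>auto simp: root_radius_def d_def[symmetric] simp del: of_real_divide of_real_add of_real_diff\<close>)
next
  case False
  define d where "d = sqrt (4 * b - a\<^sup>2)"
  have d: "d\<^sup>2 = 4 * b - a\<^sup>2" using False by (auto simp: d_def)
  have b: "b \<ge> 0" using False zero_le_power2[of a] by linarith
  have "cmod (Complex (a/2) (d/2)) = sqrt b" "cmod (Complex (a/2) (-d/2)) = sqrt b"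
    using d by (simp_all add: cmod_def power_divide add_divide_distrib[symmetric])
  moreover have "a * a + d * d = b * 4" using d by (simp add: power2_eq_square)
  ultimately show ?thesis
    by (intro that[of "Complex (a/2) (d/2)" "Complex (a/2) (-d/2)"])
      (use False in \<open>auto simp: complex_eq_iff root_radius_def\<close>)
qed

text \<open>By Bernoulli's inequality the factor \<open>n\<close> that accompanies a (nearly) double root costs only the
  margin \<open>\<eta>\<close> in the rate.\<close>

lemma nat_power_le_margin:
  fixes R \<eta> :: real
  assumes "0 \<le> R" "0 < \<eta>"
  shows "real n * R ^ (n - 1) \<le> (R + \<eta>) ^ n / \<eta>"
proof -
  have "R ^ n + real n * R ^ (n - 1) * \<eta> \<le> (R + \<eta>) ^ n"
  proof (induction n)
    case (Suc n)
    have "R ^ Suc n + real (Suc n) * R ^ n * \<eta> = R * (R ^ n + real n * R ^ (n - 1) * \<eta>) + \<eta> * R ^ n"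
      by (cases n) (auto simp: algebra_simps)
    also have "\<dots> \<le> R * (R + \<eta>) ^ n + \<eta> * (R + \<eta>) ^ n"
      using assms Suc by (intro add_mono mult_left_mono power_mono) auto
    finally show ?case by (simp add: algebra_simps)
  qed simp
  moreover have "0 \<le> R ^ n" using assms by simp
  ultimately have "real n * R ^ (n - 1) * \<eta> \<le> (R + \<eta>) ^ n" by linarith
  then show ?thesis using assms by (simp add: pos_le_divide_eq)
qed

text \<open>The constant depends on the margin only and not on the coefficients. This is what makes all later
  estimates uniform in the step size and the momentum.\<close>

lemma recurrence_bound:
  fixes t :: "nat \<Rightarrow> real"
  assumes rec: "\<And>n. t (Suc (Suc n)) = a * t (Suc n) - b * t n"
    and R: "root_radius a b \<le> R" "R \<le> 1" and \<eta>: "0 < \<eta>"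
  shows "\<bar>t n\<bar> \<le> (1 + 1 / \<eta>) * (\<bar>t 0\<bar> + \<bar>t 1\<bar>) * (R + \<eta>) ^ n"
proof -
  have R0: "0 \<le> R" using root_radius_nonneg R(1) by (rule order_trans)
  obtain r s :: complex where rs: "r + s = of_real a" "r * s = of_real b"
    and "cmod r \<le> root_radius a b" "cmod s \<le> root_radius a b"
    by (rule quadratic_roots_in_disc)
  then have r: "cmod r \<le> R" and s: "cmod s \<le> R" using R(1) by linarith+
  define D where "D = \<bar>t 0\<bar> + \<bar>t 1\<bar>"
  \<comment> \<open>Factor the recurrence into two one-term recurrences with multipliers \<open>r\<close> and \<open>s\<close>.\<close>
  have diff: "of_real (t (Suc n)) - s * of_real (t n) = r ^ n * (of_real (t 1) - s * of_real (t 0))" for n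
  proof (induction n)
    case (Suc n)
    have "of_real (t (Suc (Suc n))) - s * of_real (t (Suc n))
        = (r + s) * of_real (t (Suc n)) - r * s * of_real (t n) - s * of_real (t (Suc n))"
      by (simp add: rec rs)
    also have "\<dots> = r * (of_real (t (Suc n)) - s * of_real (t n))" by (simp add: algebra_simps)
    finally show ?case using Suc by simp
  qed simp
  have init: "cmod (of_real (t 1) - s * of_real (t 0)) \<le> D"
  proof -
    have "cmod (of_real (t 1) - s * of_real (t 0)) \<le> \<bar>t 1\<bar> + cmod s * \<bar>t 0\<bar>"
      by (rule order_trans[OF norm_triangle_ineq4]) (simp add: norm_mult)
    also have "cmod s * \<bar>t 0\<bar> \<le> 1 * \<bar>t 0\<bar>" using s R by (intro mult_right_mono) auto
    finally show ?thesis by (simp add: D_def)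
  qed
  have bound: "\<bar>t n\<bar> \<le> R ^ n * \<bar>t 0\<bar> + real n * R ^ (n - 1) * D"
  proof (induction n)
    case (Suc n)
    have "of_real (t (Suc n)) = s * of_real (t n) + r ^ n * (of_real (t 1) - s * of_real (t 0))"
      using diff[of n] by (simp add: algebra_simps)
    then have "\<bar>t (Suc n)\<bar> = cmod (s * of_real (t n) + r ^ n * (of_real (t 1) - s * of_real (t 0)))"
      by (simp only: norm_of_real[symmetric, where ?'a = complex])
    also have "\<dots> \<le> cmod s * \<bar>t n\<bar> + cmod r ^ n * cmod (of_real (t 1) - s * of_real (t 0))"
      by (rule order_trans[OF norm_triangle_ineq]) (simp add: norm_mult norm_power)
    also have "\<dots> \<le> R * (R ^ n * \<bar>t 0\<bar> + real n * R ^ (n - 1) * D) + R ^ n * D"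
    proof (rule add_mono)
      show "cmod s * \<bar>t n\<bar> \<le> R * (R ^ n * \<bar>t 0\<bar> + real n * R ^ (n - 1) * D)"
        using s R0 by (intro mult_mono[OF s Suc]) simp_all
      show "cmod r ^ n * cmod (of_real (t 1) - s * of_real (t 0)) \<le> R ^ n * D"
        using R0 by (intro mult_mono[OF power_mono[OF r] init]) simp_all
    qed
    also have "\<dots> = R ^ Suc n * \<bar>t 0\<bar> + real (Suc n) * R ^ (Suc n - 1) * D"
      by (cases n) (auto simp: algebra_simps)
    finally show ?case .
  qed (simp add: D_def)
  have "R ^ n \<le> (R + \<eta>) ^ n" using R0 \<eta> by (intro power_mono) auto
  then have "R ^ n * \<bar>t 0\<bar> \<le> (R + \<eta>) ^ n * D"
    using R0 \<eta> by (intro mult_mono) (auto simp: D_def)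
  moreover have "real n * R ^ (n - 1) * D \<le> (R + \<eta>) ^ n / \<eta> * D"
    using nat_power_le_margin[OF R0 \<eta>, of n] by (intro mult_right_mono) (auto simp: D_def)
  ultimately have "\<bar>t n\<bar> \<le> (R + \<eta>) ^ n * D + (R + \<eta>) ^ n / \<eta> * D"
    using bound by linarith
  then show ?thesis by (simp add: D_def algebra_simps)
qed

lemma geometric_le_imp_le:
  fixes r q C :: real
  assumes "0 \<le> r" "0 < q" and le: "\<And>n. n \<ge> 1 \<Longrightarrow> r ^ n \<le> C * q ^ n"
  shows "r \<le> q"
proof (rule ccontr)
  assume "\<not> r \<le> q"
  then have gt: "1 < r / q" using assms by (simp add: field_simps)
  obtain n where n: "max C 0 < (r / q) ^ n"
    using real_arch_pow[OF gt] by blast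
  have "(r / q) ^ n \<le> (r / q) ^ Suc n" using gt by (intro power_increasing) auto
  moreover have "(r / q) ^ Suc n \<le> C"
    using le[of "Suc n"] assms(2) by (simp only: power_divide) (simp add: pos_divide_le_eq)
  ultimately show False using n by linarith
qed

text \<open>Conversely the root radius bounds every geometric rate that holds for all solutions: for a
  dominant real root \<open>r\<close> take the solution \<open>r\<^sup>n\<close>; for complex roots use that the Casoratian form
  \<open>t\<^sub>n\<^sub>+\<^sub>1\<^sup>2 - a t\<^sub>n\<^sub>+\<^sub>1 t\<^sub>n + b t\<^sub>n\<^sup>2\<close> is multiplied by \<open>b\<close> in every step.\<close>

lemma root_radius_le_rate:
  fixes q :: real
  assumes q: "0 < q"
    and bound: "\<And>t n. (\<And>n. t (Suc (Suc n)) = a * t (Suc n) - b * t n) \<Longrightarrow> n \<ge> 1 \<Longrightarrow>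
      \<bar>t n\<bar> \<le> C * (\<bar>t 1\<bar> + \<bar>t 0\<bar>) * q ^ n"
  shows "root_radius a b \<le> q"
proof (cases "4 * b \<le> a\<^sup>2")
  case True
  define d where "d = sqrt (a\<^sup>2 - 4 * b)"
  have d: "0 \<le> d" "d\<^sup>2 = a\<^sup>2 - 4 * b" using True by (auto simp: d_def)
  define r where "r = (if a \<ge> 0 then (a + d) / 2 else (a - d) / 2)"
  have "\<bar>r\<bar> = root_radius a b" using True d by (simp add: r_def root_radius_def d_def[symmetric])
  have root: "r * r = a * r - b" using d by (auto simp: r_def field_simps power2_eq_square)
  have "\<bar>r\<bar> \<le> q"
  proof (rule geometric_le_imp_le)
    fix n :: nat assume n: "n \<ge> 1"
    have "r ^ Suc (Suc n) = a * r ^ Suc n - b * r ^ n" for n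
    proof -
      have "r ^ Suc (Suc n) = (r * r) * r ^ n" by simp
      then show ?thesis by (simp add: root algebra_simps)
    qed
    from bound[of "\<lambda>n. r ^ n", OF this n] show "\<bar>r\<bar> ^ n \<le> (C * (\<bar>r\<bar> + 1)) * q ^ n"
      by (simp add: power_abs)
  qed (use q in auto)
  then show ?thesis using \<open>\<bar>r\<bar> = root_radius a b\<close> by simp
next
  case False
  then have b: "0 \<le> b" using zero_le_power2[of a] by linarith
  define t where "t = rec_nat (\<lambda>x y. x) (\<lambda>_ u x y. u y (a * y - b * x))"
  define u where "u n = t n 0 1" for n
  have gen: "t (Suc (Suc n)) x y = a * t (Suc n) x y - b * t n x y" for n x y
    by (induction n arbitrary: x y) (simp_all add: t_def)
  have u: "u (Suc (Suc n)) = a * u (Suc n) - b * u n" for n unfolding u_def by (rule gen)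
  have u01: "u 0 = 0" "u 1 = 1" by (auto simp: u_def t_def)
  have casorati: "(u (Suc n))\<^sup>2 - a * u (Suc n) * u n + b * (u n)\<^sup>2 = b ^ n" for n
  proof (induction n)
    case (Suc n)
    have "(u (Suc (Suc n)))\<^sup>2 - a * u (Suc (Suc n)) * u (Suc n) + b * (u (Suc n))\<^sup>2
        = b * ((u (Suc n))\<^sup>2 - a * u (Suc n) * u n + b * (u n)\<^sup>2)"
      unfolding u by (simp add: power2_eq_square algebra_simps)
    then show ?case using Suc by simp
  qed (use u01 in simp)
  have C: "0 \<le> C"
  proof -
    have "0 < C * q" using bound[of u 1, OF u] u01 by simp
    then show ?thesis using q by (simp add: zero_less_mult_iff)
  qed
  have ub: "\<bar>u n\<bar> \<le> C * q ^ n" if "n \<ge> 1" for n using bound[of u n, OF u that] u01 by simp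
  define K where "K = C * C * (q * q + \<bar>a\<bar> * q + b)"
  have "b \<le> q\<^sup>2"
  proof (rule geometric_le_imp_le)
    fix n :: nat assume n: "n \<ge> 1"
    have s: "\<bar>u (Suc n)\<bar> \<le> C * q ^ Suc n" by (rule ub) simp
    have sq: "(u (Suc n))\<^sup>2 \<le> (C * q ^ Suc n)\<^sup>2" "(u n)\<^sup>2 \<le> (C * q ^ n)\<^sup>2"
      using power_mono[OF s, of 2] power_mono[OF ub[OF n], of 2] by simp_all
    have prod: "\<bar>u (Suc n)\<bar> * \<bar>u n\<bar> \<le> (C * q ^ Suc n) * (C * q ^ n)"
      using s ub[OF n] q C by (intro mult_mono) auto
    have "b ^ n \<le> (u (Suc n))\<^sup>2 + \<bar>a\<bar> * (\<bar>u (Suc n)\<bar> * \<bar>u n\<bar>) + b * (u n)\<^sup>2"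
      using casorati[of n] abs_ge_minus_self[of "a * u (Suc n) * u n"]
      by (simp add: abs_mult mult.assoc)
    also have "\<dots> \<le> (C * q ^ Suc n)\<^sup>2 + \<bar>a\<bar> * ((C * q ^ Suc n) * (C * q ^ n)) + b * (C * q ^ n)\<^sup>2"
      using sq prod b by (intro add_mono mult_left_mono) auto
    also have "\<dots> = K * (q\<^sup>2) ^ n"
      by (simp add: K_def power2_eq_square power_mult_distrib algebra_simps)
    finally show "b ^ n \<le> K * (q\<^sup>2) ^ n" .
  qed (use b q in auto)
  then have "sqrt b \<le> q" using q by (intro real_le_lsqrt) auto
  then show ?thesis using False by (simp add: root_radius_def)
qed

section \<open>The spectral rate of NAG and its optimal parameters\<close>

text \<open>Along an eigenvector with eigenvalue \<open>\<lambda>\<close> NAG is the recurrence with characteristic polynomial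
  \<open>t\<^sup>2 - (1 + \<beta>) c t + \<beta> c\<close>, where \<open>c = 1 - \<alpha> \<lambda>\<close>.\<close>

definition mode_radius :: "real \<Rightarrow> real \<Rightarrow> real" where
  "mode_radius \<beta> c = root_radius ((1 + \<beta>) * c) (\<beta> * c)"

lemma mode_radius_le_iff:
  assumes "0 \<le> \<beta>" "0 \<le> R"
  shows "mode_radius \<beta> c \<le> R \<longleftrightarrow>
    \<beta> * \<bar>c\<bar> \<le> R\<^sup>2 \<and> (1 + \<beta>) * \<bar>c\<bar> \<le> 2 * R \<and> (1 + \<beta>) * \<bar>c\<bar> * R \<le> R\<^sup>2 + \<beta> * c"
  using assms unfolding mode_radius_def root_radius_le_iff[OF assms(2)] by (simp add: abs_mult)

text \<open>By convexity of the test a whole interval of eigenvalues is controlled by its endpoints.\<close>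

lemma mode_radius_between:
  assumes \<beta>: "0 \<le> \<beta>" and R: "0 \<le> R" and c: "c1 \<le> c" "c \<le> c2"
    and 1: "mode_radius \<beta> c1 \<le> R" and 2: "mode_radius \<beta> c2 \<le> R"
  shows "mode_radius \<beta> c \<le> R"
proof (cases "0 \<le> c")
  case True
  have a: "\<bar>c\<bar> \<le> \<bar>c2\<bar>" using True c by simp
  have "c * ((1 + \<beta>) * R - \<beta>) \<le> R\<^sup>2"
  proof (cases "0 \<le> (1 + \<beta>) * R - \<beta>")
    case nonneg: True
    have "c * ((1 + \<beta>) * R - \<beta>) \<le> c2 * ((1 + \<beta>) * R - \<beta>)"
      using c(2) nonneg by (rule mult_right_mono)
    also have "\<dots> \<le> R\<^sup>2"
      using 2 True c by (simp add: mode_radius_le_iff \<beta> R algebra_simps)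
    finally show ?thesis .
  next
    case False
    then have "c * ((1 + \<beta>) * R - \<beta>) \<le> 0" using True by (simp add: mult_nonneg_nonpos)
    then show ?thesis using zero_le_power2[of R] by linarith
  qed
  moreover have "\<beta> * \<bar>c\<bar> \<le> \<beta> * \<bar>c2\<bar>" "(1 + \<beta>) * \<bar>c\<bar> \<le> (1 + \<beta>) * \<bar>c2\<bar>"
    using a \<beta> by (auto intro: mult_left_mono)
  ultimately show ?thesis
    using 2 True by (auto simp: mode_radius_le_iff \<beta> R algebra_simps)
next
  case False
  have a: "\<bar>c\<bar> \<le> \<bar>c1\<bar>" using False c by simp
  have "\<bar>c\<bar> * ((1 + \<beta>) * R + \<beta>) \<le> \<bar>c1\<bar> * ((1 + \<beta>) * R + \<beta>)"
    using a \<beta> R by (intro mult_right_mono) auto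
  also have "\<dots> \<le> R\<^sup>2"
    using 1 False c by (simp add: mode_radius_le_iff \<beta> R algebra_simps)
  finally have "\<bar>c\<bar> * ((1 + \<beta>) * R + \<beta>) \<le> R\<^sup>2" .
  moreover have "\<beta> * \<bar>c\<bar> \<le> \<beta> * \<bar>c1\<bar>" "(1 + \<beta>) * \<bar>c\<bar> \<le> (1 + \<beta>) * \<bar>c1\<bar>"
    using a \<beta> by (auto intro: mult_left_mono)
  ultimately show ?thesis
    using 1 False by (auto simp: mode_radius_le_iff \<beta> R algebra_simps)
qed

lemma mode_radius_less_one:
  assumes \<beta>: "0 \<le> \<beta>" "\<beta> < 1" and c: "c < 1" "- 1 < c * (2 * \<beta> + 1)"
  shows "mode_radius \<beta> c < 1"
proof -
  have "\<beta> * c < 1"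
  proof (cases "0 \<le> c")
    case True
    then have "\<beta> * c \<le> 1 * c" using \<beta> by (intro mult_right_mono) auto
    then show ?thesis using c(1) by simp
  next
    case False
    then have "\<beta> * c \<le> 0" using \<beta> by (simp add: mult_nonneg_nonpos)
    then show ?thesis by simp
  qed
  moreover have third: "(1 + \<beta>) * \<bar>c\<bar> < 1 + \<beta> * c"
  proof (cases "0 \<le> c")
    case False
    then show ?thesis using c(2) by (simp add: algebra_simps)
  qed (use c in \<open>simp add: algebra_simps\<close>)
  moreover have "(1 + \<beta>) * \<bar>c\<bar> < 2"
    using third \<open>\<beta> * c < 1\<close> by linarith
  ultimately show ?thesis
    unfolding mode_radius_def using \<beta> by (intro root_radius_less_one) (simp_all add: abs_mult)
qed

text \<open>No parameters beat the optimal rate. Let \<open>R\<close> bound both radii. The test for \<open>\<mu>\<close> bounds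
  \<open>1 - \<alpha> \<mu>\<close> from above and the test for \<open>L\<close> bounds \<open>1 - \<alpha> L\<close> from below, so \<open>\<mu> / L\<close> is bounded from
  below by a function of \<open>\<beta>\<close> and \<open>R\<close>. That function is smallest at \<open>\<beta> = R / (2 - R)\<close>, where the
  characteristic polynomial for \<open>\<mu>\<close> has a double root; its value there is
  \<open>3 (1 - R)\<^sup>2 / ((3 - R) (1 + R))\<close>, and solving for \<open>R\<close> gives the rate.\<close>

lemma squared_rate_gap_le:
  fixes \<alpha> \<beta> \<mu> L R :: real
  assumes \<alpha>: "0 < \<alpha>" and \<beta>: "0 \<le> \<beta>" "\<beta> < 1" and R: "0 < R" "R < 1" and \<mu>: "0 < \<mu>" and L: "0 < L"
    and rad_\<mu>: "mode_radius \<beta> (1 - \<alpha> * \<mu>) \<le> R" and rad_L: "mode_radius \<beta> (1 - \<alpha> * L) \<le> R"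
  shows "(1 - R)\<^sup>2 * (3 * L + \<mu>) \<le> 4 * \<mu>"
proof -
  define c d where "c = 1 - \<alpha> * \<mu>" and "d = \<alpha> * L - 1"
  have c2: "\<beta> * c \<le> R\<^sup>2" "(R - \<beta> * (1 - R)) * c \<le> R\<^sup>2"
  proof -
    have "\<beta> * \<bar>c\<bar> \<le> R\<^sup>2" and third: "(1 + \<beta>) * \<bar>c\<bar> * R \<le> R\<^sup>2 + \<beta> * c"
      using rad_\<mu> mode_radius_le_iff[of \<beta> R c] \<beta> R by (auto simp: c_def)
    moreover have "\<beta> * c \<le> \<beta> * \<bar>c\<bar>" using \<beta> by (simp add: mult_left_mono)
    ultimately show "\<beta> * c \<le> R\<^sup>2" by linarith
    have "(1 + \<beta>) * R * c \<le> (1 + \<beta>) * R * \<bar>c\<bar>" using \<beta> R by (intro mult_left_mono) auto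
    then show "(R - \<beta> * (1 - R)) * c \<le> R\<^sup>2" using third by (simp add: algebra_simps)
  qed
  have d2: "(R + \<beta> * (1 + R)) * d \<le> R\<^sup>2"
  proof -
    have "(1 + \<beta>) * \<bar>- d\<bar> * R \<le> R\<^sup>2 + \<beta> * (- d)"
      using rad_L mode_radius_le_iff[of \<beta> R "- d"] \<beta> R by (auto simp: d_def)
    moreover have "(1 + \<beta>) * R * d \<le> (1 + \<beta>) * R * \<bar>d\<bar>" using \<beta> R by (intro mult_left_mono) auto
    ultimately show ?thesis by (simp add: algebra_simps)
  qed
  have "3 * (1 - R)\<^sup>2 * (1 + d) \<le> (3 - R) * (1 + R) * (1 - c)"
  proof (cases "\<beta> * (2 - R) \<le> R")
    case True
    define D1 D2 where "D1 = R - \<beta> * (1 - R)" and "D2 = R + \<beta> * (1 + R)"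
    have "D1 > 0"
    proof (cases "\<beta> = 0")
      case False
      then show ?thesis using True \<beta> unfolding D1_def by (simp add: algebra_simps)
    qed (use R in \<open>simp add: D1_def\<close>)
    moreover have "D2 > 0" using R \<beta> by (simp add: D2_def add_pos_nonneg)
    ultimately have D: "0 < D1 * D2" by simp
    \<comment> \<open>The factor vanishing at \<open>\<beta> = R / (2 - R)\<close> shows that the bound is sharp there.\<close>
    have "(R - \<beta>) * D2 * (3 - R) - 3 * (1 - R) * (R + \<beta>) * D1 = 2 * R * (R - \<beta> * (2 - R)) * (R + 2 * \<beta>)"
      unfolding D1_def D2_def by (simp add: algebra_simps)
    moreover have "0 \<le> 2 * R * (R - \<beta> * (2 - R)) * (R + 2 * \<beta>)"
      using True R \<beta> by (intro mult_nonneg_nonneg) auto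
    ultimately have poly: "3 * (1 - R) * (R + \<beta>) * D1 \<le> (R - \<beta>) * D2 * (3 - R)" by linarith
    have mu: "(1 - R) * (R - \<beta>) \<le> D1 * (1 - c)"
      using c2(2) unfolding D1_def by (simp add: algebra_simps power2_eq_square)
    have ell: "D2 * (1 + d) \<le> (1 + R) * (R + \<beta>)"
      using d2 unfolding D2_def by (simp add: algebra_simps power2_eq_square)
    have "(D1 * D2) * (3 * (1 - R)\<^sup>2 * (1 + d)) = (3 * (1 - R)\<^sup>2 * D1) * (D2 * (1 + d))"
      by (simp add: algebra_simps)
    also have "\<dots> \<le> (3 * (1 - R)\<^sup>2 * D1) * ((1 + R) * (R + \<beta>))"
      using \<open>D1 > 0\<close> by (intro mult_left_mono ell) auto
    also have "\<dots> = ((1 - R) * (1 + R)) * (3 * (1 - R) * (R + \<beta>) * D1)"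
      by (simp add: power2_eq_square algebra_simps)
    also have "\<dots> \<le> ((1 - R) * (1 + R)) * ((R - \<beta>) * D2 * (3 - R))"
      using R by (intro mult_left_mono poly mult_nonneg_nonneg) auto
    also have "\<dots> = (D2 * (3 - R) * (1 + R)) * ((1 - R) * (R - \<beta>))"
      by (simp add: algebra_simps)
    also have "\<dots> \<le> (D2 * (3 - R) * (1 + R)) * (D1 * (1 - c))"
      using \<open>D2 > 0\<close> R by (intro mult_left_mono mu mult_nonneg_nonneg) auto
    also have "\<dots> = (D1 * D2) * ((3 - R) * (1 + R) * (1 - c))"
      by (simp add: algebra_simps)
    finally show ?thesis using D by (rule mult_left_le_imp_le)
  next
    case False
    have c3: "c \<le> R * (2 - R)"
    proof (cases "c \<le> 0")
      case True
      moreover have "0 \<le> R * (2 - R)" using R by simp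
      ultimately show ?thesis by linarith
    next
      case pos: False
      have "R * c \<le> \<beta> * (2 - R) * c" using False pos by (intro mult_right_mono) auto
      also have "\<dots> = (2 - R) * (\<beta> * c)" by simp
      also have "\<dots> \<le> (2 - R) * R\<^sup>2" using c2(1) R by (intro mult_left_mono) auto
      also have "\<dots> = R * (R * (2 - R))" by (simp add: power2_eq_square)
      finally show ?thesis using R by (simp add: mult_le_cancel_left_pos)
    qed
    have d3: "3 * d \<le> R * (2 - R)"
    proof (cases "d \<le> 0")
      case True
      have "0 \<le> R * (2 - R)" using R by simp
      then show ?thesis using True by linarith
    next
      case pos: False
      have "R * (3 * d) = (R * (2 - R) + R * (1 + R)) * d" by (simp add: algebra_simps)
      also have "\<dots> \<le> (R * (2 - R) + \<beta> * (2 - R) * (1 + R)) * d"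
        using False pos R by (intro mult_right_mono add_left_mono) auto
      also have "\<dots> = (2 - R) * ((R + \<beta> * (1 + R)) * d)" by (simp add: algebra_simps)
      also have "\<dots> \<le> (2 - R) * R\<^sup>2" using d2 R by (intro mult_left_mono) auto
      also have "\<dots> = R * (R * (2 - R))" by (simp add: power2_eq_square)
      finally show ?thesis using R by (simp add: mult_le_cancel_left_pos)
    qed
    have nn: "0 \<le> (3 - R) * (1 + R)" using R by (intro mult_nonneg_nonneg) auto
    have "(1 - R)\<^sup>2 * (3 * (1 + d)) \<le> (1 - R)\<^sup>2 * ((3 - R) * (1 + R))"
      using d3 by (intro mult_left_mono) (auto simp: algebra_simps)
    also have "\<dots> = ((3 - R) * (1 + R)) * (1 - R)\<^sup>2" by simp
    also have "\<dots> \<le> ((3 - R) * (1 + R)) * (1 - c)"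
      using c3 by (intro mult_left_mono[OF _ nn]) (auto simp: power2_eq_square algebra_simps)
    finally show ?thesis by (simp add: algebra_simps)
  qed
  then have "\<alpha> * (3 * (1 - R)\<^sup>2 * L) \<le> \<alpha> * ((3 - R) * (1 + R) * \<mu>)"
    by (simp add: c_def d_def algebra_simps)
  then have "3 * (1 - R)\<^sup>2 * L \<le> (3 - R) * (1 + R) * \<mu>"
    using \<alpha> by (rule mult_left_le_imp_le)
  moreover have "(3 - R) * (1 + R) * \<mu> = 4 * \<mu> - (1 - R)\<^sup>2 * \<mu>"
    by (simp add: power2_eq_square algebra_simps)
  ultimately show ?thesis by (simp add: algebra_simps)
qed

lemma optimal_rate_le_radius:
  fixes \<alpha> \<beta> \<mu> L R :: real
  assumes \<alpha>: "0 < \<alpha>" and \<beta>: "0 \<le> \<beta>" "\<beta> < 1" and R: "0 \<le> R" and \<mu>: "0 < \<mu>" and L: "0 < L"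
    and rad_\<mu>: "mode_radius \<beta> (1 - \<alpha> * \<mu>) \<le> R" and rad_L: "mode_radius \<beta> (1 - \<alpha> * L) \<le> R"
  shows "(sqrt (3 * L + \<mu>) - 2 * sqrt \<mu>) / sqrt (3 * L + \<mu>) \<le> R"
  \<comment> \<open>Enlarging \<open>R\<close> slightly covers the case \<open>R = 0\<close>.\<close>
proof (rule field_le_epsilon)
  fix e :: real assume e: "0 < e"
  define s where "s = sqrt (3 * L + \<mu>)"
  have s: "0 < s" using L \<mu> by (simp add: s_def)
  show "(sqrt (3 * L + \<mu>) - 2 * sqrt \<mu>) / sqrt (3 * L + \<mu>) \<le> R + e"
  proof (cases "R + e < 1")
    case True
    have "(1 - (R + e))\<^sup>2 * (3 * L + \<mu>) \<le> 4 * \<mu>"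
      using True e R rad_\<mu> rad_L by (intro squared_rate_gap_le[OF \<alpha> \<beta>] \<mu> L) auto
    then have "sqrt ((1 - (R + e))\<^sup>2 * (3 * L + \<mu>)) \<le> sqrt (4 * \<mu>)" by (rule real_sqrt_le_mono)
    then have "(1 - (R + e)) * s \<le> 2 * sqrt \<mu>"
      using True by (simp add: real_sqrt_mult s_def)
    then show ?thesis using s unfolding s_def[symmetric] by (simp add: divide_le_eq algebra_simps)
  next
    case False
    have "(s - 2 * sqrt \<mu>) / s \<le> 1" using s \<mu> by simp
    then show ?thesis using False unfolding s_def by linarith
  qed
qed

text \<open>The factor \<open>\<beta>\<close> is the rate at which increments along the kernel of the Hessian decay.\<close>

definition nag_rate :: "real \<Rightarrow> real \<Rightarrow> real \<Rightarrow> real \<Rightarrow> real" where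
  "nag_rate \<mu> L \<alpha> \<beta> = max \<beta> (max (mode_radius \<beta> (1 - \<alpha> * \<mu>)) (mode_radius \<beta> (1 - \<alpha> * L)))"

lemma mode_radius_le_nag_rate:
  assumes "0 \<le> \<beta>" "0 \<le> \<alpha>" "\<mu> \<le> l" "l \<le> L"
  shows "mode_radius \<beta> (1 - \<alpha> * l) \<le> nag_rate \<mu> L \<alpha> \<beta>"
  by (rule mode_radius_between[of \<beta> _ "1 - \<alpha> * L" _ "1 - \<alpha> * \<mu>"])
    (use assms in \<open>auto simp: nag_rate_def mult_left_mono\<close>)

lemma step_size_bound:
  fixes \<alpha> \<beta> L :: real
  assumes "0 \<le> \<beta>" "0 < L" "\<alpha> < 2 * (\<beta> + 1) / (L * (2 * \<beta> + 1))"
  shows "- 1 < (1 - \<alpha> * L) * (2 * \<beta> + 1)"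
proof -
  have "0 < L * (2 * \<beta> + 1)" using assms by simp
  then have "\<alpha> * (L * (2 * \<beta> + 1)) < 2 * (\<beta> + 1)"
    using assms(3) by (simp only: pos_less_divide_eq)
  then show ?thesis by (simp add: algebra_simps)
qed

lemma nag_rate_less_one:
  assumes \<beta>: "0 \<le> \<beta>" "\<beta> < 1" and \<mu>: "0 < \<mu>" "\<mu> \<le> L"
    and \<alpha>: "0 < \<alpha>" "\<alpha> < 2 * (\<beta> + 1) / (L * (2 * \<beta> + 1))"
  shows "nag_rate \<mu> L \<alpha> \<beta> < 1"
proof -
  have L: "- 1 < (1 - \<alpha> * L) * (2 * \<beta> + 1)" using assms by (intro step_size_bound) auto
  have "(1 - \<alpha> * L) * (2 * \<beta> + 1) \<le> (1 - \<alpha> * \<mu>) * (2 * \<beta> + 1)"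
    using assms by (intro mult_right_mono) auto
  with L have "- 1 < (1 - \<alpha> * \<mu>) * (2 * \<beta> + 1)" by linarith
  then have "mode_radius \<beta> (1 - \<alpha> * \<mu>) < 1" "mode_radius \<beta> (1 - \<alpha> * L) < 1"
    using L mult_pos_pos[OF \<alpha>(1) \<mu>(1)] mult_pos_pos[OF \<alpha>(1), of L] \<mu>
    by (simp_all add: mode_radius_less_one[OF \<beta>])
  then show ?thesis using \<beta> by (simp add: nag_rate_def)
qed

context
  fixes \<mu> L s m :: real
  assumes \<mu>: "0 < \<mu>" "\<mu> \<le> L"
  defines "s \<equiv> sqrt (3 * L + \<mu>)" and "m \<equiv> 2 * sqrt \<mu>"
begin

lemma opt_roots: "0 < m" "m \<le> s" "s\<^sup>2 = 3 * L + \<mu>" "m\<^sup>2 = 4 * \<mu>"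
proof -
  have "sqrt (4 * \<mu>) \<le> s" unfolding s_def using \<mu> by (intro real_sqrt_le_mono) auto
  then show "m \<le> s" by (simp add: m_def real_sqrt_mult)
qed (use \<mu> in \<open>auto simp: m_def s_def power_mult_distrib\<close>)

lemma optimal_parameters_range:
  "0 < 4 / (3 * L + \<mu>)" "0 \<le> (s - m) / (s + m)" "(s - m) / (s + m) < 1"
  "0 \<le> (s - m) / s" "(s - m) / s < 1"
  using opt_roots \<mu> by (auto simp: divide_simps)

lemma nag_rate_optimal: "nag_rate \<mu> L (4 / (3 * L + \<mu>)) ((s - m) / (s + m)) = (s - m) / s"
proof -
  define \<alpha> \<beta> R where "\<alpha> = 4 / (3 * L + \<mu>)" and "\<beta> = (s - m) / (s + m)" and "R = (s - m) / s"
  note ms = opt_roots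
  have sp: "0 < s" using ms by linarith
  have R: "0 \<le> R" "R < 1" and \<beta>: "0 \<le> \<beta>" "\<beta> < 1" and \<alpha>: "0 < \<alpha>"
    using optimal_parameters_range by (auto simp: R_def \<beta>_def \<alpha>_def)
  have mR: "m = s * (1 - R)" using sp by (simp add: R_def field_simps)
  have \<beta>R: "\<beta> = R / (2 - R)"
  proof -
    have "2 - R = (s + m) / s" using sp by (simp add: R_def field_simps)
    moreover have "R / ((s + m) / s) = \<beta>" using sp by (simp add: R_def \<beta>_def)
    ultimately show ?thesis by simp
  qed
  \<comment> \<open>The optimum balances the ends of the spectrum: \<open>R\<close> satisfies the last inequality of the
    Schur--Jury test with equality for both \<open>\<mu>\<close> and \<open>L\<close>.\<close>
  have c\<mu>: "1 - \<alpha> * \<mu> = R * (2 - R)"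
  proof -
    have "\<alpha> * \<mu> = m\<^sup>2 / s\<^sup>2" using ms by (simp add: \<alpha>_def)
    also have "\<dots> = (1 - R)\<^sup>2" using sp by (simp add: mR power_mult_distrib)
    finally show ?thesis by (simp add: power2_eq_square algebra_simps)
  qed
  have "3 * (1 - \<alpha> * L) = - (1 - \<alpha> * \<mu>)"
    using \<mu> unfolding \<alpha>_def by (simp add: field_simps)
  then have cL: "3 * (1 - \<alpha> * L) = - (R * (2 - R))" unfolding c\<mu> .
  have eqs: "\<beta> * (R * (2 - R)) = R\<^sup>2" "(1 + \<beta>) * (R * (2 - R)) = 2 * R"
    using R unfolding \<beta>R by (simp_all add: field_simps power2_eq_square)
  have nn: "0 \<le> R * (2 - R)" using R by simp
  have "mode_radius \<beta> (1 - \<alpha> * \<mu>) \<le> R"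
    unfolding mode_radius_le_iff[OF \<beta>(1) R(1)] c\<mu> abs_of_nonneg[OF nn] eqs
    by (simp add: power2_eq_square)
  moreover have "mode_radius \<beta> (1 - \<alpha> * L) \<le> R"
  proof -
    define Y where "Y = - (1 - \<alpha> * L)"
    have Y3: "R * (2 - R) = 3 * Y" using cL unfolding Y_def by linarith
    have Y: "3 * (\<beta> * Y) = R\<^sup>2" "3 * ((1 + \<beta>) * Y) = 2 * R" "0 \<le> Y"
      using eqs nn unfolding Y3 by (simp_all add: algebra_simps)
    have "3 * ((1 + \<beta>) * Y * R) = (3 * ((1 + \<beta>) * Y)) * R" by simp
    also have "\<dots> = 2 * R\<^sup>2" unfolding Y(2) by (simp add: power2_eq_square)
    finally have "(1 + \<beta>) * Y * R \<le> R\<^sup>2 - \<beta> * Y" "\<beta> * Y \<le> R\<^sup>2"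
      using Y(1) zero_le_power2[of R] by linarith+
    moreover have "(1 + \<beta>) * Y \<le> 2 * R" using Y(2) R by linarith
    ultimately have "mode_radius \<beta> (- Y) \<le> R"
      unfolding mode_radius_le_iff[OF \<beta>(1) R(1)] using Y(3) by simp
    then show ?thesis by (simp add: Y_def)
  qed
  moreover have "\<beta> \<le> R" using R unfolding \<beta>R by (simp add: divide_le_eq mult_le_cancel_left1)
  ultimately have "nag_rate \<mu> L \<alpha> \<beta> \<le> R" by (simp add: nag_rate_def)
  moreover have "R \<le> nag_rate \<mu> L \<alpha> \<beta>"
    using optimal_rate_le_radius[OF \<alpha> \<beta>, of "nag_rate \<mu> L \<alpha> \<beta>" \<mu> L] \<beta> \<mu>
    unfolding R_def s_def m_def by (simp add: nag_rate_def)
  ultimately show ?thesis by (simp add: \<alpha>_def \<beta>_def R_def)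
qed

end

section \<open>Gradients and Hessians\<close>

lemma gradient_eqI:
  assumes "GDERIV f x :> D"
  shows "gradient f x = D"
proof -
  have "D' = D" if "GDERIV f x :> D'" for D'
  proof -
    have "(\<lambda>h. h \<bullet> D') = (\<lambda>h. h \<bullet> D)"
      using that assms unfolding gderiv_def by (rule has_derivative_unique)
    then show ?thesis unfolding fun_eq_iff vector_eq_ldot .
  qed
  then show ?thesis unfolding gradient_def by (rule the_equality[where P = "\<lambda>D. GDERIV f x :> D", OF assms])
qed

lemma GDERIV_gradient:
  fixes f :: "'a::euclidean_space \<Rightarrow> real"
  assumes "f differentiable (at x)"
  shows "GDERIV f x :> gradient f x"
proof -
  obtain f' where f': "(f has_derivative f') (at x)" using assms by (auto simp: differentiable_def)
  define D where "D = adjoint f' 1"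
  have "f' = (\<lambda>h. h \<bullet> D)"
    using adjoint_works[OF has_derivative_linear[OF f'], of _ 1] by (auto simp: fun_eq_iff D_def)
  then have "GDERIV f x :> D"
    using f' unfolding gderiv_def by simp
  then show ?thesis using gradient_eqI[of f x] by simp
qed

lemma GDERIV_imp_DERIV_line:
  assumes "GDERIV f (p + t *\<^sub>R v) :> D"
  shows "((\<lambda>t. f (p + t *\<^sub>R v)) has_real_derivative v \<bullet> D) (at t)"
proof -
  have "((\<lambda>t. p + t *\<^sub>R v) has_derivative (\<lambda>h. h *\<^sub>R v)) (at t)"
    by (auto intro!: derivative_eq_intros)
  then have "((\<lambda>t. f (p + t *\<^sub>R v)) has_derivative (\<lambda>h. (h *\<^sub>R v) \<bullet> D)) (at t)"
    using has_derivative_compose[of "\<lambda>t. p + t *\<^sub>R v" "\<lambda>h. h *\<^sub>R v" t UNIV f "\<lambda>h. h \<bullet> D"] assms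
    unfolding gderiv_def by simp
  then show ?thesis by (simp add: has_field_derivative_def mult.commute[of _ "v \<bullet> D"])
qed

text \<open>Symmetry of second derivatives: by the mean value theorem the second difference
  \<open>f (z + s u + s v) - f (z + s u) - f (z + s v) + f z\<close> is \<open>s\<^sup>2 (u \<bullet> T v)\<close> up to \<open>o(s\<^sup>2)\<close>, and it is
  symmetric in \<open>u\<close> and \<open>v\<close>.\<close>

lemma second_difference_estimate:
  fixes f :: "'a::real_inner \<Rightarrow> real"
  assumes g: "\<And>x. GDERIV f x :> g x" and lin: "linear T" and e: "0 < e" and s: "0 < s"
    and approx: "\<And>y. norm (y - z) < d \<Longrightarrow> norm (g y - g z - T (y - z)) \<le> e * norm (y - z)"
    and sd: "s * (norm u + norm v) < d"
  shows "\<bar>f (z + s *\<^sub>R u + s *\<^sub>R v) - f (z + s *\<^sub>R u) - f (z + s *\<^sub>R v) + f z - s\<^sup>2 * (u \<bullet> T v)\<bar>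
    \<le> s\<^sup>2 * (2 * e * (norm u + norm v)\<^sup>2)"
proof -
  interpret linear T by fact
  define \<phi> where "\<phi> t = f (z + s *\<^sub>R v + t *\<^sub>R u) - f (z + t *\<^sub>R u)" for t
  define \<phi>' where "\<phi>' t = u \<bullet> g (z + s *\<^sub>R v + t *\<^sub>R u) - u \<bullet> g (z + t *\<^sub>R u)" for t
  define N where "N = norm u + norm v"
  have "DERIV \<phi> t :> \<phi>' t" for t
    unfolding \<phi>_def \<phi>'_def by (intro derivative_intros GDERIV_imp_DERIV_line g)
  then have "\<exists>t>0. t < s \<and> \<phi> s - \<phi> 0 = (s - 0) * \<phi>' t" by (rule MVT2[OF s])
  then obtain t where t: "0 < t" "t < s" "\<phi> s - \<phi> 0 = s * \<phi>' t"
    unfolding diff_0_right by blast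
  define p q where "p = s *\<^sub>R v + t *\<^sub>R u" and "q = t *\<^sub>R u"
  have "norm p \<le> s * norm v + s * norm u"
    unfolding p_def using t s by (intro order_trans[OF norm_triangle_ineq] add_mono) (auto intro: mult_right_mono)
  then have p: "norm p \<le> s * N" by (simp add: N_def algebra_simps)
  have "norm q \<le> s * norm u" unfolding q_def using t by (auto intro: mult_right_mono)
  also have "\<dots> \<le> s * N" using s by (simp add: N_def)
  finally have q: "norm q \<le> s * N" .
  have small: "s * N < d" using sd by (simp add: N_def)
  have "norm (g (z + p) - g z - T p) \<le> e * norm p" "norm (g (z + q) - g z - T q) \<le> e * norm q"
    using approx[of "z + p"] approx[of "z + q"] p q small by auto
  moreover have "e * norm p \<le> e * (s * N)" "e * norm q \<le> e * (s * N)"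
    using p q e by simp_all
  ultimately have pq: "norm (g (z + p) - g z - T p) \<le> e * (s * N)" "norm (g (z + q) - g z - T q) \<le> e * (s * N)"
    by linarith+
  have "T p = s *\<^sub>R T v + T q" by (simp add: p_def q_def add scale)
  then have split: "g (z + p) - g (z + q) - s *\<^sub>R T v = (g (z + p) - g z - T p) - (g (z + q) - g z - T q)"
    by simp
  have "norm (g (z + p) - g (z + q) - s *\<^sub>R T v)
      \<le> norm (g (z + p) - g z - T p) + norm (g (z + q) - g z - T q)"
    unfolding split by (rule norm_triangle_ineq4)
  then have "norm (g (z + p) - g (z + q) - s *\<^sub>R T v) \<le> 2 * e * (s * N)"
    using pq by linarith
  then have "\<bar>u \<bullet> (g (z + p) - g (z + q) - s *\<^sub>R T v)\<bar> \<le> norm u * (2 * e * (s * N))"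
    by (intro order_trans[OF Cauchy_Schwarz_ineq2] mult_left_mono) auto
  also have "\<dots> \<le> N * (2 * e * (s * N))"
    using e s by (intro mult_right_mono) (auto simp: N_def)
  finally have est: "\<bar>\<phi>' t - s * (u \<bullet> T v)\<bar> \<le> N * (2 * e * (s * N))"
    by (simp add: \<phi>'_def p_def q_def inner_diff_right add.assoc)
  have "f (z + s *\<^sub>R u + s *\<^sub>R v) - f (z + s *\<^sub>R u) - f (z + s *\<^sub>R v) + f z = \<phi> s - \<phi> 0"
    by (simp add: \<phi>_def add.commute add.left_commute)
  then have "f (z + s *\<^sub>R u + s *\<^sub>R v) - f (z + s *\<^sub>R u) - f (z + s *\<^sub>R v) + f z - s\<^sup>2 * (u \<bullet> T v)
      = s * (\<phi>' t - s * (u \<bullet> T v))"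
    using t(3) by (simp add: power2_eq_square algebra_simps)
  then have "\<bar>f (z + s *\<^sub>R u + s *\<^sub>R v) - f (z + s *\<^sub>R u) - f (z + s *\<^sub>R v) + f z - s\<^sup>2 * (u \<bullet> T v)\<bar>
      = s * \<bar>\<phi>' t - s * (u \<bullet> T v)\<bar>"
    using s by (simp add: abs_mult)
  also have "\<dots> \<le> s * (N * (2 * e * (s * N)))" using s est by (intro mult_left_mono) auto
  also have "\<dots> = s\<^sup>2 * (2 * e * N\<^sup>2)" by (simp add: power2_eq_square)
  finally show ?thesis by (simp add: N_def)
qed

lemma gradient_derivative_self_adjoint:
  fixes f :: "'a::real_inner \<Rightarrow> real"
  assumes g: "\<And>x. GDERIV f x :> g x" and T: "(g has_derivative T) (at z)"
  shows "T u \<bullet> v = u \<bullet> T v"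
proof -
  have lin: "linear T" using T by (rule has_derivative_linear)
  define N where "N = norm u + norm v"
  have small: "\<bar>u \<bullet> T v - v \<bullet> T u\<bar> \<le> 4 * e * N\<^sup>2" if e: "0 < e" for e
  proof -
    obtain d where d: "0 < d"
      and approx: "\<And>y. norm (y - z) < d \<Longrightarrow> norm (g y - g z - T (y - z)) \<le> e * norm (y - z)"
      using T e unfolding has_derivative_at_alt by blast
    define s where "s = d / (2 * (N + 1))"
    have N: "0 \<le> N" by (simp add: N_def)
    have "N * d + d * 2 > 0" using d N by (simp add: add_nonneg_pos)
    then have s: "0 < s" "s * N < d" using d N by (auto simp: s_def field_simps)
    have 1: "\<bar>f (z + s *\<^sub>R u + s *\<^sub>R v) - f (z + s *\<^sub>R u) - f (z + s *\<^sub>R v) + f z - s\<^sup>2 * (u \<bullet> T v)\<bar>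
        \<le> s\<^sup>2 * (2 * e * (norm u + norm v)\<^sup>2)"
      by (rule second_difference_estimate[OF g lin e s(1) approx]) (use s(2) in \<open>simp_all add: N_def\<close>)
    have 2: "\<bar>f (z + s *\<^sub>R v + s *\<^sub>R u) - f (z + s *\<^sub>R v) - f (z + s *\<^sub>R u) + f z - s\<^sup>2 * (v \<bullet> T u)\<bar>
        \<le> s\<^sup>2 * (2 * e * (norm v + norm u)\<^sup>2)"
      by (rule second_difference_estimate[OF g lin e s(1) approx]) (use s(2) in \<open>simp_all add: N_def add.commute\<close>)
    have comm: "z + s *\<^sub>R v + s *\<^sub>R u = z + s *\<^sub>R u + s *\<^sub>R v" "norm v + norm u = N" by (simp_all add: N_def)
    have "\<bar>s\<^sup>2 * (u \<bullet> T v) - s\<^sup>2 * (v \<bullet> T u)\<bar> \<le> s\<^sup>2 * (2 * e * N\<^sup>2) + s\<^sup>2 * (2 * e * N\<^sup>2)"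
      using 1 2 unfolding comm N_def[symmetric] by linarith
    moreover have "s\<^sup>2 * \<bar>u \<bullet> T v - v \<bullet> T u\<bar> = \<bar>s\<^sup>2 * (u \<bullet> T v) - s\<^sup>2 * (v \<bullet> T u)\<bar>"
      by (simp add: abs_mult right_diff_distrib[symmetric])
    moreover have "s\<^sup>2 * (2 * e * N\<^sup>2) + s\<^sup>2 * (2 * e * N\<^sup>2) = s\<^sup>2 * (4 * e * N\<^sup>2)" by simp
    ultimately have "s\<^sup>2 * \<bar>u \<bullet> T v - v \<bullet> T u\<bar> \<le> s\<^sup>2 * (4 * e * N\<^sup>2)" by linarith
    then show ?thesis using s(1) by simp
  qed
  have "\<bar>u \<bullet> T v - v \<bullet> T u\<bar> \<le> 0"
  proof (rule field_le_epsilon)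
    fix \<eta> :: real assume \<eta>: "0 < \<eta>"
    define e where "e = \<eta> / (4 * (N\<^sup>2 + 1))"
    have "0 < N\<^sup>2 + 1" using zero_le_power2[of N] by linarith
    then have "0 < e" "4 * e * N\<^sup>2 \<le> \<eta>" using \<eta> by (auto simp: e_def field_simps)
    then show "\<bar>u \<bullet> T v - v \<bullet> T u\<bar> \<le> 0 + \<eta>" using small by force
  qed
  then show ?thesis by (simp add: inner_commute)
qed

lemma gradient_zero_at_minimum:
  assumes "GDERIV f z :> D" "open V" "z \<in> V" "\<forall>y\<in>V. f z \<le> f y"
  shows "D = 0"
proof -
  have "(\<lambda>h. h \<bullet> D) = (\<lambda>h. 0)"
    using differential_zero_maxmin[of z V f "\<lambda>h. h \<bullet> D"] assms unfolding gderiv_def by blast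
  then have "D \<bullet> D = 0" by (rule fun_cong)
  then show ?thesis by simp
qed

lemma second_order_necessary_condition:
  fixes f :: "'a::real_inner \<Rightarrow> real"
  assumes g: "\<And>x. GDERIV f x :> g x" and T: "(g has_derivative T) (at z)"
    and V: "open V" "z \<in> V" "\<forall>y\<in>V. f z \<le> f y"
  shows "0 \<le> v \<bullet> T v"
proof (rule ccontr)
  assume negative: "\<not> 0 \<le> v \<bullet> T v"
  interpret linear T using T by (rule has_derivative_linear)
  have v: "v \<noteq> 0" using negative by auto
  have gz: "g z = 0" using gradient_zero_at_minimum[OF g V] .
  define e where "e = - (v \<bullet> T v) / (2 * (norm v)\<^sup>2)"
  have e: "0 < e" using negative v by (simp add: e_def divide_neg_pos)
  have ev: "e * (norm v)\<^sup>2 = - (v \<bullet> T v) / 2" using v by (simp add: e_def)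
  obtain d where d: "0 < d"
    and approx: "\<And>y. norm (y - z) < d \<Longrightarrow> norm (g y - g z - T (y - z)) \<le> e * norm (y - z)"
    using T e unfolding has_derivative_at_alt by blast
  obtain r where r: "0 < r" "ball z r \<subseteq> V" using V open_contains_ball by blast
  define s where "s = min d r / (2 * norm v)"
  have s: "0 < s" "s * norm v < d" "s * norm v < r" using d r v by (auto simp: s_def)
  have "\<exists>t>0. t < s \<and> f (z + s *\<^sub>R v) - f (z + 0 *\<^sub>R v) = (s - 0) * (v \<bullet> g (z + t *\<^sub>R v))"
    using GDERIV_imp_DERIV_line[OF g] by (rule MVT2[OF s(1)])
  then obtain t where t: "0 < t" "t < s" "f (z + s *\<^sub>R v) - f (z + 0 *\<^sub>R v) = (s - 0) * (v \<bullet> g (z + t *\<^sub>R v))"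
    by blast
  have "t * norm v < s * norm v" using t(2) v by (intro mult_strict_right_mono) auto
  then have "t * norm v < d" using s(2) by linarith
  then have "norm (g (z + t *\<^sub>R v) - t *\<^sub>R T v) \<le> e * (t * norm v)"
    using approx[of "z + t *\<^sub>R v"] t gz by (simp add: scale)
  then have "v \<bullet> (g (z + t *\<^sub>R v) - t *\<^sub>R T v) \<le> norm v * (e * (t * norm v))"
    by (intro order_trans[OF norm_cauchy_schwarz] mult_left_mono) auto
  also have "\<dots> = t * (e * (norm v)\<^sup>2)" by (simp add: power2_eq_square)
  finally have "v \<bullet> g (z + t *\<^sub>R v) \<le> t * (v \<bullet> T v) / 2"
    by (simp add: inner_diff_right ev)
  also have "\<dots> < 0" using t(1) negative by (simp add: mult_pos_neg)
  finally have "s * (v \<bullet> g (z + t *\<^sub>R v)) < 0" using s(1) by (rule mult_pos_neg[rotated])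
  then have "f (z + s *\<^sub>R v) < f z" using t(3) by simp
  moreover have "z + s *\<^sub>R v \<in> V" using r(2) s by (auto simp: dist_norm)
  ultimately show False using V(3) by force
qed

lemma norm_component_matrix_le: "\<bar>A $ i $ j\<bar> \<le> norm (A :: real ^ 'n ^ 'm)"
  using Finite_Cartesian_Product.norm_nth_le[of "A $ i" j] Finite_Cartesian_Product.norm_nth_le[of A i]
  by simp

lemma twice_continuously_differentiableD:
  fixes f :: "real ^ 'n \<Rightarrow> real"
  assumes "twice_continuously_differentiable f"
  shows "GDERIV f x :> gradient f x"
    and "(gradient f has_derivative (\<lambda>h. hessian f x *v h)) (at x)"
    and "continuous_on UNIV (hessian f)"
  using assms unfolding twice_continuously_differentiable_def hessian_def
  by (auto simp: GDERIV_gradient jacobian_works)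

text \<open>Continuity of the Hessian makes the gradient strictly differentiable: the linearisation at
  \<open>z\<close> approximates all difference quotients near \<open>z\<close>, not only those based at \<open>z\<close>.\<close>

lemma gradient_strictly_differentiable:
  fixes f :: "real ^ 'n \<Rightarrow> real"
  assumes C2: "twice_continuously_differentiable f" and e: "0 < e"
  obtains r where "0 < r" "\<And>x y. x \<in> ball z r \<Longrightarrow> y \<in> ball z r \<Longrightarrow>
    norm (gradient f x - gradient f y - hessian f z *v (x - y)) \<le> e * norm (x - y)"
proof -
  define n where "n = real CARD('n) * real CARD('n)"
  have n: "0 < n" by (simp add: n_def)
  have "isCont (hessian f) z"
    using twice_continuously_differentiableD(3)[OF C2] continuous_on_eq_continuous_at[of UNIV] by blast
  moreover have "0 < e / n" using e n by simp
  ultimately obtain r where r: "0 < r"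
    and close: "\<And>x. dist x z < r \<Longrightarrow> dist (hessian f x) (hessian f z) < e / n"
    unfolding continuous_at_eps_delta by blast
  have onorm_le: "onorm ((*v) (hessian f x - hessian f z)) \<le> e" if "x \<in> ball z r" for x
  proof -
    have "norm (hessian f x - hessian f z) < e / n"
      using close[of x] that by (simp add: dist_norm norm_minus_commute)
    then have "\<bar>(hessian f x - hessian f z) $ i $ j\<bar> \<le> e / n" for i j
      using norm_component_matrix_le[of "hessian f x - hessian f z" i j] by linarith
    then have "onorm ((*v) (hessian f x - hessian f z)) \<le> n * (e / n)"
      unfolding n_def by (rule onorm_le_matrix_component)
    then show ?thesis using n by simp
  qed
  show thesis
  proof (rule that[OF r])
    fix x y assume x: "x \<in> ball z r" and y: "y \<in> ball z r"
    have seg: "y + t *\<^sub>R (x - y) \<in> ball z r" if "t \<in> {0..1}" for t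
    proof -
      have "(1 - t) *\<^sub>R y + t *\<^sub>R x \<in> ball z r"
        using convex_ball x y that by (intro convexD) auto
      then show ?thesis by (simp add: algebra_simps)
    qed
    have "norm (gradient f x - gradient f y - (\<lambda>w. (*v) (hessian f w)) z (x - y)) \<le> norm (x - y) * e"
    proof (rule differentiable_bound_linearization[of y x "ball z r" "gradient f" "\<lambda>w. (*v) (hessian f w)" z e])
      show "onorm ((*v) (hessian f w) - (*v) (hessian f z)) \<le> e" if "w \<in> ball z r" for w
      proof -
        have "(*v) (hessian f w) - (*v) (hessian f z) = (*v) (hessian f w - hessian f z)"
          by (auto simp: fun_eq_iff matrix_vector_mult_diff_rdistrib)
        then show ?thesis using onorm_le[OF that] by simp
      qed
    qed (use seg r in \<open>auto intro: has_derivative_at_withinI twice_continuously_differentiableD(2)[OF C2]\<close>)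
    then show "norm (gradient f x - gradient f y - hessian f z *v (x - y)) \<le> e * norm (x - y)"
      by (simp add: mult.commute)
  qed
qed

section \<open>The error bound implied by the PL condition\<close>

text \<open>The distance to the set of minimisers is at most a multiple of the norm of the gradient. A
  minimiser \<open>x'\<close> of \<open>y \<mapsto> sqrt (f y - f z) + \<kappa> \<bar>y - x\<bar>\<close> over a small ball exists by compactness
  and lies in the interior. The PL condition says that the gradient of \<open>sqrt (f - f z)\<close> has norm at
  least \<open>sqrt (\<nu> / 2) > \<kappa>\<close> wherever \<open>f > f z\<close>, so a step along the negative gradient would lower
  the value at \<open>x'\<close> unless \<open>f x' = f z\<close>. Minimality compared with \<open>y = x\<close> then bounds \<open>\<bar>x' - x\<bar>\<close>.\<close>

lemma PL_error_bound:
  fixes f :: "'a::euclidean_space \<Rightarrow> real"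
  assumes g: "\<And>x. GDERIV f x :> g x"
    and V: "open V" "z \<in> V" and min: "\<And>y. y \<in> V \<Longrightarrow> f z \<le> f y"
    and \<nu>: "0 < \<nu>" and PL: "\<And>y. y \<in> V \<Longrightarrow> 2 * \<nu> * (f y - f z) \<le> (norm (g y))\<^sup>2"
    and \<rho>: "0 < \<rho>"
  obtains r where "0 < r" "\<And>x. x \<in> ball z r \<Longrightarrow>
    \<exists>x'\<in>ball z \<rho>. f x' = f z \<and> g x' = 0 \<and> norm (x - x') \<le> 2 / \<nu> * norm (g x)"
proof -
  obtain R0 where R0: "0 < R0" "cball z R0 \<subseteq> V" using V open_contains_cball by blast
  define R where "R = min R0 (\<rho> / 2)"
  have R: "0 < R" "cball z R \<subseteq> V" "cball z R \<subseteq> ball z \<rho>" using R0 \<rho> by (auto simp: R_def)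
  define h where "h y = f y - f z" for y
  define \<kappa> where "\<kappa> = sqrt (2 * \<nu>) / 4"
  have \<kappa>: "0 < \<kappa>" and \<kappa>\<nu>: "\<kappa> * sqrt (2 * \<nu>) = \<nu> / 2" using \<nu> by (auto simp: \<kappa>_def)
  have h: "0 \<le> h y" "sqrt (2 * \<nu>) * sqrt (h y) \<le> norm (g y)" if "y \<in> V" for y
  proof -
    show "0 \<le> h y" using min[OF that] by (simp add: h_def)
    have "sqrt (2 * \<nu> * h y) \<le> norm (g y)" using PL[OF that] by (intro real_le_lsqrt) (auto simp: h_def)
    then show "sqrt (2 * \<nu>) * sqrt (h y) \<le> norm (g y)" by (simp only: real_sqrt_mult)
  qed
  have contf: "continuous_on S f" for S
    using has_derivative_continuous[OF g[unfolded gderiv_def]] by (simp add: continuous_at_imp_continuous_on)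
  then have conth: "continuous_on S h" for S unfolding h_def by (intro continuous_intros) auto
  have "isCont h z" using conth[of UNIV] by (simp add: continuous_on_eq_continuous_at)
  moreover have "0 < (\<kappa> * R / 2)\<^sup>2" using \<kappa> R by simp
  ultimately obtain r0 where r0: "0 < r0" and close: "\<And>x. dist x z < r0 \<Longrightarrow> dist (h x) (h z) < (\<kappa> * R / 2)\<^sup>2"
    unfolding continuous_at_eps_delta by blast
  define r where "r = min r0 (R / 2)"
  have r: "0 < r" using r0 R by (simp add: r_def)
  show thesis
  proof (rule that[OF r])
    fix x assume x: "x \<in> ball z r"
    have xR: "x \<in> cball z R" and xz: "dist x z < R / 2" using x R(1) by (auto simp: r_def dist_commute)
    have xV: "x \<in> V" using xR R(2) by blast
    define \<psi> where "\<psi> y = sqrt (h y) + \<kappa> * norm (y - x)" for y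
    have cont\<psi>: "continuous_on (cball z R) \<psi>" unfolding \<psi>_def by (intro continuous_intros conth)
    have ne: "cball z R \<noteq> {}" using xR by blast
    obtain x' where x': "x' \<in> cball z R" and \<psi>_min: "\<And>y. y \<in> cball z R \<Longrightarrow> \<psi> x' \<le> \<psi> y"
      using continuous_attains_inf[OF compact_cball ne cont\<psi>] by blast
    have x'V: "x' \<in> V" using x' R(2) by blast
    have "h x < (\<kappa> * R / 2)\<^sup>2" using close[of x] x by (simp add: r_def dist_commute h_def dist_real_def)
    then have hx: "sqrt (h x) < \<kappa> * R / 2" using \<kappa> R by (intro real_less_lsqrt) auto
    have bound: "\<kappa> * norm (x' - x) \<le> sqrt (h x) - sqrt (h x')" using \<psi>_min[OF xR] by (simp add: \<psi>_def)
    moreover have "0 \<le> sqrt (h x')" using h(1)[OF x'V] by simp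
    ultimately have "\<kappa> * norm (x' - x) < \<kappa> * R / 2" using hx by linarith
    then have "\<kappa> * norm (x' - x) < \<kappa> * (R / 2)" by simp
    then have "norm (x' - x) < R / 2" using \<kappa> by (simp only: mult_less_cancel_left_pos)
    then have inner: "norm (x' - z) < R"
      using xz norm_triangle_ineq[of "x' - x" "x - z"] by (simp add: dist_norm)
    have hx'0: "h x' = 0"
    proof (rule ccontr)
      assume "h x' \<noteq> 0"
      then have hp: "0 < h x'" using h(1)[OF x'V] by simp
      define D where "D = norm (g x')"
      have D: "sqrt (2 * \<nu>) * sqrt (h x') \<le> D" unfolding D_def by (rule h(2)[OF x'V])
      moreover have "0 < sqrt (2 * \<nu>) * sqrt (h x')" using hp \<nu> by simp
      ultimately have Dp: "0 < D" by linarith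
      define \<theta> where "\<theta> = (\<lambda>t. sqrt (h (x' + t *\<^sub>R (- g x'))) + \<kappa> * (t * D))"
      have "((\<lambda>t. h (x' + t *\<^sub>R (- g x'))) has_real_derivative - g x' \<bullet> g x') (at 0)"
        unfolding h_def using DERIV_diff[OF GDERIV_imp_DERIV_line[of f x' 0 "- g x'" "g x'"] DERIV_const[of "f z"]] g[of x']
        by simp
      moreover have "(sqrt has_real_derivative inverse (sqrt (h x')) / 2) (at (h (x' + 0 *\<^sub>R (- g x'))))"
        using DERIV_real_sqrt[OF hp] by simp
      ultimately have "((\<lambda>t. sqrt (h (x' + t *\<^sub>R (- g x')))) has_real_derivative
          (inverse (sqrt (h x')) / 2) * (- g x' \<bullet> g x')) (at 0)"
        by (rule DERIV_chain2[rotated])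
      then have "(\<theta> has_real_derivative (inverse (sqrt (h x')) / 2) * (- g x' \<bullet> g x') + \<kappa> * (1 * D)) (at 0)"
        unfolding \<theta>_def by (intro DERIV_add DERIV_cmult DERIV_cmult_right DERIV_ident)
      then have "(\<theta> has_real_derivative (inverse (sqrt (h x')) / 2) * (- g x' \<bullet> g x') + \<kappa> * D) (at 0)"
        by simp
      moreover have "(inverse (sqrt (h x')) / 2) * (- g x' \<bullet> g x') + \<kappa> * D < 0"
      proof -
        define w where "w = sqrt (h x')"
        have w: "0 < w" using hp by (simp add: w_def)
        have "4 * \<kappa> * w \<le> D" using D by (simp add: \<kappa>_def w_def)
        moreover have "0 < \<kappa> * w" using \<kappa> w by simp
        ultimately have "2 * \<kappa> * w < D" by linarith
        then have "(2 * \<kappa> * w) * D < D * D" using Dp by (intro mult_strict_right_mono)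
        then have "\<kappa> * D < D * D / (2 * w)" using w by (simp add: field_simps)
        moreover have "- g x' \<bullet> g x' = - (D * D)" by (simp add: D_def dot_square_norm power2_eq_square)
        then have "inverse w / 2 * (- g x' \<bullet> g x') = - (D * D / (2 * w))" by (simp add: field_simps)
        ultimately show ?thesis unfolding w_def[symmetric] by linarith
      qed
      ultimately have "\<exists>d>0. \<forall>t>0. t < d \<longrightarrow> \<theta> (0 + t) < \<theta> 0" by (rule DERIV_neg_dec_right)
      then obtain d where d: "0 < d" and dec: "\<And>t. 0 < t \<Longrightarrow> t < d \<Longrightarrow> \<theta> t < \<theta> 0"
        unfolding add_0 by blast
      define t where "t = min (d / 2) ((R - norm (x' - z)) / (2 * D))"
      have t: "0 < t" "t < d" using d inner Dp by (auto simp: t_def)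
      define y where "y = x' + t *\<^sub>R (- g x')"
      have "t * D \<le> (R - norm (x' - z)) / (2 * D) * D" unfolding t_def using Dp by (intro mult_right_mono) auto
      then have tD: "t * D \<le> R - norm (x' - z)" using Dp inner by simp
      have yx': "norm (y - x') = t * D" using t by (simp add: y_def D_def)
      have "norm (y - z) \<le> norm (y - x') + norm (x' - z)" using norm_triangle_ineq[of "y - x'" "x' - z"] by simp
      then have "y \<in> cball z R" using tD yx' by (simp add: dist_norm norm_minus_commute)
      then have "\<psi> x' \<le> \<psi> y" by (rule \<psi>_min)
      also have "\<psi> y \<le> sqrt (h y) + \<kappa> * (t * D + norm (x' - x))"
        unfolding \<psi>_def using \<kappa> yx' norm_triangle_ineq[of "y - x'" "x' - x"] by (simp add: mult_left_mono)
      also have "\<dots> = \<theta> t + \<kappa> * norm (x' - x)" by (simp add: \<theta>_def y_def algebra_simps)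
      also have "\<dots> < \<theta> 0 + \<kappa> * norm (x' - x)" using dec[OF t] by simp
      also have "\<dots> = \<psi> x'" by (simp add: \<theta>_def \<psi>_def)
      finally show False by simp
    qed
    have fx': "f x' = f z" using hx'0 by (simp add: h_def)
    have "g x' = 0" using gradient_zero_at_minimum[OF g V(1) x'V] min fx' by simp
    moreover have "norm (x - x') \<le> 2 / \<nu> * norm (g x)"
    proof -
      have "(\<nu> / 2) * norm (x - x') = sqrt (2 * \<nu>) * (\<kappa> * norm (x' - x))"
        unfolding \<kappa>\<nu>[symmetric] by (simp add: norm_minus_commute)
      also have "\<dots> \<le> sqrt (2 * \<nu>) * sqrt (h x)"
        using bound hx'0 \<nu> by (intro mult_left_mono) auto
      also have "\<dots> \<le> norm (g x)" by (rule h(2)[OF xV])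
      finally show ?thesis using \<nu> by (simp add: field_simps)
    qed
    ultimately show "\<exists>x'\<in>ball z \<rho>. f x' = f z \<and> g x' = 0 \<and> norm (x - x') \<le> 2 / \<nu> * norm (g x)"
      using fx' x' R(3) by blast
  qed
qed

section \<open>Perturbed linear iterations\<close>

text \<open>A perturbation that is small relative to the current iterate costs only \<open>C \<delta>\<close> in the rate.
  The induction works because it bounds all powers of \<open>A\<close> on \<open>u n\<close> at once: this replaces passing to
  a norm in which \<open>A\<close> contracts.\<close>

lemma perturbed_power_bound:
  fixes A :: "'a::real_normed_vector \<Rightarrow> 'a"
  assumes lin: "linear A"
    and pow: "\<And>k w. norm ((A ^^ k) w) \<le> C * q ^ k * norm w"
    and C: "0 \<le> C" and q: "0 \<le> q" and \<delta>: "0 \<le> \<delta>"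
    and step: "\<And>n. n < N \<Longrightarrow> norm (u (Suc n) - A (u n)) \<le> \<delta> * norm (u n)"
    and n: "n \<le> N"
  shows "norm (u n) \<le> C * (q + C * \<delta>) ^ n * norm (u 0)"
proof -
  have lin_pow: "(A ^^ k) (x + y) = (A ^^ k) x + (A ^^ k) y" for k x y
    by (induction k) (simp_all add: linear_add[OF lin])
  have "norm ((A ^^ k) (u n)) \<le> C * q ^ k * (q + C * \<delta>) ^ n * norm (u 0)" for k
    using n
  proof (induction n arbitrary: k)
    case 0
    show ?case using pow[of k "u 0"] by simp
  next
    case (Suc n)
    define E where "E = (q + C * \<delta>) ^ n * norm (u 0)"
    have IH: "norm ((A ^^ k) (u n)) \<le> C * q ^ k * E" for k using Suc by (simp add: E_def mult.assoc)
    have un: "norm (u n) \<le> C * E" using IH[of 0] by simp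
    have "(A ^^ k) (u (Suc n)) = (A ^^ k) (A (u n)) + (A ^^ k) (u (Suc n) - A (u n))"
      using lin_pow[of k "A (u n)" "u (Suc n) - A (u n)"] by simp
    also have "(A ^^ k) (A (u n)) = (A ^^ Suc k) (u n)" by (simp only: funpow_Suc_right o_apply)
    finally have "norm ((A ^^ k) (u (Suc n)))
        \<le> norm ((A ^^ Suc k) (u n)) + norm ((A ^^ k) (u (Suc n) - A (u n)))"
      using norm_triangle_ineq[of "(A ^^ Suc k) (u n)" "(A ^^ k) (u (Suc n) - A (u n))"] by (simp only:)
    also have "\<dots> \<le> C * q ^ Suc k * E + C * q ^ k * (\<delta> * (C * E))"
    proof (rule add_mono[OF IH])
      have "norm ((A ^^ k) (u (Suc n) - A (u n))) \<le> C * q ^ k * norm (u (Suc n) - A (u n))" by (rule pow)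
      also have "\<dots> \<le> C * q ^ k * (\<delta> * norm (u n))"
        using step[of n] Suc.prems C q by (intro mult_left_mono) auto
      also have "\<dots> \<le> C * q ^ k * (\<delta> * (C * E))"
        using C q \<delta> by (intro mult_left_mono[OF mult_left_mono[OF un]]) auto
      finally show "norm ((A ^^ k) (u (Suc n) - A (u n))) \<le> C * q ^ k * (\<delta> * (C * E))" .
    qed
    also have "\<dots> = C * q ^ k * (q + C * \<delta>) ^ Suc n * norm (u 0)" by (simp add: E_def algebra_simps)
    finally show ?case .
  qed
  from this[of 0] show ?thesis by simp
qed

text \<open>A sequence whose steps decay geometrically as long as it stays near \<open>z\<close> does stay near \<open>z\<close> if
  it starts close enough, and then converges.\<close>

lemma confined_geometric_sequence:
  fixes x :: "nat \<Rightarrow> 'a::banach"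
  assumes \<theta>: "0 \<le> \<theta>" "\<theta> < 1" and D: "0 \<le> D"
    and start: "norm (x 0 - z) + D / (1 - \<theta>) < r"
    and step: "\<And>n. (\<And>k. k \<le> n \<Longrightarrow> norm (x k - z) < r) \<Longrightarrow> norm (x (Suc n) - x n) \<le> D * \<theta> ^ n"
  obtains x' where "\<And>n. norm (x n - z) < r" "x \<longlonglongrightarrow> x'"
    "\<And>n. norm (x n - x') \<le> D * \<theta> ^ n / (1 - \<theta>)"
proof -
  have tail: "D * \<theta> ^ n + D * \<theta> ^ Suc n / (1 - \<theta>) = D * \<theta> ^ n / (1 - \<theta>)" for n
    using \<theta> by (simp add: field_simps)
  have near: "norm (x n - z) + D * \<theta> ^ n / (1 - \<theta>) < r" for n
  proof (induction n rule: nat_less_induct)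
    case (1 n)
    show ?case
    proof (cases n)
      case 0
      then show ?thesis using start by simp
    next
      case (Suc m)
      have IH: "norm (x k - z) + D * \<theta> ^ k / (1 - \<theta>) < r" if "k \<le> m" for k using 1 that Suc by simp
      have pos: "0 \<le> D * \<theta> ^ k / (1 - \<theta>)" for k using \<theta> D by simp
      have "norm (x k - z) < r" if "k \<le> m" for k using IH[OF that] pos[of k] by linarith
      then have "norm (x (Suc m) - x m) \<le> D * \<theta> ^ m" by (rule step)
      moreover have "norm (x (Suc m) - z) \<le> norm (x (Suc m) - x m) + norm (x m - z)"
        using norm_triangle_ineq[of "x (Suc m) - x m" "x m - z"] by simp
      ultimately show ?thesis using IH[of m] tail[of m] Suc by simp
    qed
  qed
  have pos: "0 \<le> D * \<theta> ^ n / (1 - \<theta>)" for n using \<theta> D by simp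
  have inr: "norm (x n - z) < r" for n using near[of n] pos[of n] by linarith
  then have st: "norm (x (Suc n) - x n) \<le> D * \<theta> ^ n" for n by (rule step)
  have sums: "(\<lambda>k. D * \<theta> ^ (k + n)) sums (D * \<theta> ^ n / (1 - \<theta>))" for n
    using sums_mult[OF geometric_sums[of \<theta>], of "D * \<theta> ^ n"] \<theta> by (simp add: power_add mult.commute mult.left_commute)
  have summ: "summable (\<lambda>k. x (Suc (k + n)) - x (k + n))" for n
    by (rule summable_comparison_test'[OF sums_summable[OF sums[of n]]]) (rule st)
  define x' where "x' = x 0 + (\<Sum>k. x (Suc k) - x k)"
  have lim: "x \<longlonglongrightarrow> x'"
  proof -
    have "(\<lambda>n. \<Sum>k<n. x (Suc k) - x k) \<longlonglongrightarrow> (\<Sum>k. x (Suc k) - x k)"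
      using summ[of 0] by (simp add: summable_LIMSEQ)
    then have "(\<lambda>n. x 0 + (x n - x 0)) \<longlonglongrightarrow> x'"
      unfolding x'_def sum_lessThan_telescope by (intro tendsto_intros)
    then show ?thesis by simp
  qed
  have "norm (x n - x') \<le> D * \<theta> ^ n / (1 - \<theta>)" for n
  proof -
    have "(\<lambda>m. x (m + n)) \<longlonglongrightarrow> x'" using lim by (rule LIMSEQ_ignore_initial_segment)
    then have "(\<lambda>m. norm (x n - x (m + n))) \<longlonglongrightarrow> norm (x n - x')" by (intro tendsto_intros)
    moreover have "norm (x n - x (m + n)) \<le> D * \<theta> ^ n / (1 - \<theta>)" for m
    proof -
      have "norm (x (m + n) - x n) = norm (\<Sum>k<m. x (Suc (k + n)) - x (k + n))"
        using sum_lessThan_telescope[of "\<lambda>k. x (k + n)" m] by simp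
      also have "\<dots> \<le> (\<Sum>k<m. D * \<theta> ^ (k + n))" by (rule sum_norm_le) (rule st)
      also have "\<dots> \<le> D * \<theta> ^ n / (1 - \<theta>)"
        using sums_unique[OF sums] sum_le_suminf[OF sums_summable[OF sums[of n]], of "{..<m}"] \<theta> D by simp
      finally show ?thesis by (simp add: norm_minus_commute)
    qed
    ultimately show ?thesis by (intro LIMSEQ_le_const2) auto
  qed
  then show thesis using that inr lim by blast
qed

section \<open>The linearised increment dynamics\<close>

context eigenbasis
begin

definition ker_proj :: "'a \<Rightarrow> 'a" where
  "ker_proj w = (\<Sum>b\<in>B. (if ev b = 0 then w \<bullet> b else 0) *\<^sub>R b)"

lemma coord_ker_proj: "b \<in> B \<Longrightarrow> ker_proj w \<bullet> b = (if ev b = 0 then w \<bullet> b else 0)"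
  unfolding ker_proj_def by (rule coord_sum)

lemma linear_ker_proj: "linear ker_proj"
  by (rule linearI; rule eq_if_coords_eq) (simp_all add: coord_ker_proj inner_add_left)

lemma ker_proj_T: "ker_proj (T w) = 0"
  by (rule eq_if_coords_eq) (simp add: coord_ker_proj coord_T)

lemma T_ker_proj: "T (ker_proj w) = 0"
  by (rule eq_if_coords_eq) (simp add: coord_ker_proj coord_T)

lemma norm_ker_proj_le: "norm (ker_proj w) \<le> real (card B) * norm w"
proof -
  have "norm (ker_proj w) \<le> (\<Sum>b\<in>B. \<bar>ker_proj w \<bullet> b\<bar>)" by (rule norm_le_sum_coord)
  also have "\<dots> \<le> (\<Sum>b\<in>B. norm w)"
    by (rule sum_mono) (simp add: coord_ker_proj coord_le_norm)
  finally show ?thesis by simp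
qed

text \<open>One NAG step in terms of the increment \<open>v\<close> and the gradient \<open>g\<close> at the extrapolated point, for
  the quadratic model. The kernel component of the gradient is discarded: for the quadratic model it
  vanishes, and for \<open>f\<close> it is of higher order by the error bound. Without this a
  nontrivial kernel would make 1 an eigenvalue of the operator.\<close>

definition nag_op :: "real \<Rightarrow> real \<Rightarrow> 'a \<times> 'a \<Rightarrow> 'a \<times> 'a" where
  "nag_op \<alpha> \<beta> = (\<lambda>(v, g). let p = g - ker_proj g; w = \<beta> *\<^sub>R v - \<alpha> *\<^sub>R p in
     (w, p + T ((1 + \<beta>) *\<^sub>R w - \<beta> *\<^sub>R v)))"

lemma linear_nag_op: "linear (nag_op \<alpha> \<beta>)"
  by (rule linearI)
    (auto simp: nag_op_def Let_def linear_add[OF linear] linear_diff[OF linear] linear_scale[OF linear]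
      linear_add[OF linear_ker_proj] linear_scale[OF linear_ker_proj] algebra_simps)

lemma coord_fst_nag_op: "b \<in> B \<Longrightarrow> fst (nag_op \<alpha> \<beta> u) \<bullet> b =
    \<beta> * (fst u \<bullet> b) - \<alpha> * (if ev b = 0 then 0 else snd u \<bullet> b)"
  by (simp add: nag_op_def Let_def case_prod_beta inner_diff_left coord_ker_proj)

lemma coord_snd_nag_op: "b \<in> B \<Longrightarrow> snd (nag_op \<alpha> \<beta> u) \<bullet> b =
    (if ev b = 0 then 0 else snd u \<bullet> b + ev b * ((1 + \<beta>) * (fst (nag_op \<alpha> \<beta> u) \<bullet> b) - \<beta> * (fst u \<bullet> b)))"
  by (simp add: nag_op_def Let_def case_prod_beta inner_diff_left inner_add_left coord_ker_proj coord_T)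

text \<open>On an eigenvector with nonzero eigenvalue both components obey the characteristic recurrence of
  the mode; on the kernel the increment is multiplied by \<open>\<beta>\<close> and the gradient vanishes after one
  step.\<close>

lemma nag_op_power_coord_bound:
  fixes \<mu> L a \<alpha> \<beta> \<eta> :: real and u :: "'a \<times> 'a" and k :: nat
  assumes \<alpha>: "0 \<le> \<alpha>" "\<alpha> \<le> a" "\<alpha> * L \<le> 2" and \<beta>: "0 \<le> \<beta>" "\<beta> \<le> 1" and L: "0 \<le> L"
    and rate: "nag_rate \<mu> L \<alpha> \<beta> \<le> 1" and \<eta>: "0 < \<eta>"
    and b: "b \<in> B" and spec: "ev b = 0 \<or> \<mu> \<le> ev b \<and> ev b \<le> L \<and> 0 \<le> ev b"
  defines "M \<equiv> (1 + 1 / \<eta>) * (6 + a + 3 * L) * norm u * (nag_rate \<mu> L \<alpha> \<beta> + \<eta>) ^ k"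
  shows "\<bar>fst ((nag_op \<alpha> \<beta> ^^ k) u) \<bullet> b\<bar> \<le> M" and "\<bar>snd ((nag_op \<alpha> \<beta> ^^ k) u) \<bullet> b\<bar> \<le> M"
proof -
  define A where "A = nag_op \<alpha> \<beta>"
  define R where "R = nag_rate \<mu> L \<alpha> \<beta>"
  define p where "p n = fst ((A ^^ n) u) \<bullet> b" for n
  define s where "s n = snd ((A ^^ n) u) \<bullet> b" for n
  define N where "N = norm u"
  define K where "K = 6 + a + 3 * L"
  have R\<beta>: "\<beta> \<le> R" and R0: "0 \<le> R" and a: "0 \<le> a" and K: "1 \<le> K" and N: "0 \<le> N"
    using \<beta> \<alpha> L by (auto simp: R_def nag_rate_def K_def N_def)
  have p0: "\<bar>p 0\<bar> \<le> N" and s0: "\<bar>s 0\<bar> \<le> N"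
    using coord_le_norm[OF b, of "fst u"] coord_le_norm[OF b, of "snd u"] norm_fst_le[of "fst u" "snd u"] norm_snd_le[of "snd u" "fst u"]
    by (auto simp: p_def s_def N_def)
  have main: "\<bar>p k\<bar> \<le> (1 + 1 / \<eta>) * (K * N) * (R + \<eta>) ^ k \<and> \<bar>s k\<bar> \<le> (1 + 1 / \<eta>) * (K * N) * (R + \<eta>) ^ k"
  proof (cases "ev b = 0")
    case True
    have pS: "p (Suc n) = \<beta> * p n" and sS: "s (Suc n) = 0" for n
      using True b by (simp_all add: p_def s_def A_def coord_fst_nag_op coord_snd_nag_op)
    have pn: "p n = \<beta> ^ n * p 0" for n by (induction n) (simp_all add: pS)
    have KN: "N \<le> (1 + 1 / \<eta>) * (K * N)"
    proof -
      have "1 * N \<le> K * N" using K N by (rule mult_right_mono)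
      also have "\<dots> = 1 * (K * N)" by simp
      also have "\<dots> \<le> (1 + 1 / \<eta>) * (K * N)" using \<eta> K N by (intro mult_right_mono) auto
      finally show ?thesis by simp
    qed
    have "\<bar>p k\<bar> = \<bar>p 0\<bar> * \<beta> ^ k" using \<beta> by (simp add: pn[of k] abs_mult)
    also have "\<dots> \<le> (1 + 1 / \<eta>) * (K * N) * (R + \<eta>) ^ k"
      using p0 KN \<beta> R\<beta> \<eta> N by (intro mult_mono power_mono) auto
    finally have "\<bar>p k\<bar> \<le> (1 + 1 / \<eta>) * (K * N) * (R + \<eta>) ^ k" .
    moreover have "\<bar>s k\<bar> \<le> (1 + 1 / \<eta>) * (K * N) * (R + \<eta>) ^ k"
    proof (cases k)
      case 0
      then show ?thesis using s0 KN by simp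
    next
      case (Suc n)
      then show ?thesis using \<eta> K N R0 by (simp add: sS)
    qed
    ultimately show ?thesis ..
  next
    case False
    define l where "l = ev b"
    have l: "\<mu> \<le> l" "l \<le> L" "0 \<le> l" using spec False by (auto simp: l_def)
    have pS: "p (Suc n) = \<beta> * p n - \<alpha> * s n" for n
      using False b by (simp add: p_def s_def A_def coord_fst_nag_op)
    have sS: "s (Suc n) = s n + l * ((1 + \<beta>) * p (Suc n) - \<beta> * p n)" for n
      using False b by (simp add: p_def s_def A_def coord_snd_nag_op l_def)
    define c where "c = 1 - \<alpha> * l"
    have rp: "p (Suc (Suc n)) = ((1 + \<beta>) * c) * p (Suc n) - (\<beta> * c) * p n" for n
      unfolding pS[of "Suc n"] sS[of n] pS[of n] c_def by (simp add: algebra_simps)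
    have rs: "s (Suc (Suc n)) = ((1 + \<beta>) * c) * s (Suc n) - (\<beta> * c) * s n" for n
      unfolding sS[of "Suc n"] pS[of "Suc n"] sS[of n] pS[of n] c_def by (simp add: algebra_simps)
    have rad: "root_radius ((1 + \<beta>) * c) (\<beta> * c) \<le> R"
      unfolding c_def mode_radius_def[symmetric] R_def by (rule mode_radius_le_nag_rate[OF \<beta>(1) \<alpha>(1) l(1,2)])
    have p1e: "p 1 = \<beta> * p 0 - \<alpha> * s 0" using pS[of 0] by simp
    have p1: "\<bar>p 1\<bar> \<le> N + a * N"
    proof -
      have "\<bar>p 1\<bar> \<le> \<beta> * \<bar>p 0\<bar> + \<alpha> * \<bar>s 0\<bar>"
        using pS[of 0] abs_triangle_ineq4[of "\<beta> * p 0" "\<alpha> * s 0"] \<alpha> \<beta> by (simp add: abs_mult)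
      also have "\<dots> \<le> 1 * N + a * N" using \<alpha> \<beta> p0 s0 a by (intro add_mono mult_mono) auto
      finally show ?thesis by simp
    qed
    have s1: "\<bar>s 1\<bar> \<le> N + (4 * N + 3 * L * N)"
    proof -
      have e: "(1 + \<beta>) * p 1 - \<beta> * p 0 = \<beta> * (\<beta> * p 0) - (1 + \<beta>) * (\<alpha> * s 0)"
        unfolding p1e by (simp add: algebra_simps)
      have "\<bar>l * ((1 + \<beta>) * p 1 - \<beta> * p 0)\<bar> \<le> l * (\<beta> * (\<beta> * \<bar>p 0\<bar>)) + l * ((1 + \<beta>) * (\<alpha> * \<bar>s 0\<bar>))"
        unfolding e using abs_triangle_ineq4[of "l * (\<beta> * (\<beta> * p 0))" "l * ((1 + \<beta>) * (\<alpha> * s 0))"] \<alpha> \<beta> l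
        by (simp add: abs_mult right_diff_distrib)
      also have "\<dots> = (\<beta> * \<beta>) * (l * \<bar>p 0\<bar>) + (1 + \<beta>) * ((\<alpha> * l) * \<bar>s 0\<bar>)" by simp
      also have "\<dots> \<le> 1 * (L * N) + 2 * (2 * N)"
      proof (intro add_mono mult_mono)
        have "\<alpha> * l \<le> \<alpha> * L" using \<alpha> l by (intro mult_left_mono) auto
        then show "\<alpha> * l \<le> 2" using \<alpha> by linarith
      qed (use \<alpha> \<beta> l L p0 s0 N in \<open>auto intro: mult_le_one\<close>)
      finally have "\<bar>l * ((1 + \<beta>) * p 1 - \<beta> * p 0)\<bar> \<le> L * N + 4 * N" by simp
      moreover have "0 \<le> L * N" using L N by simp
      ultimately show ?thesis using sS[of 0] s0 abs_triangle_ineq[of "s 0" "l * ((1 + \<beta>) * p 1 - \<beta> * p 0)"] by simp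
    qed
    have sums: "\<bar>p 0\<bar> + \<bar>p 1\<bar> \<le> K * N" "\<bar>s 0\<bar> + \<bar>s 1\<bar> \<le> K * N"
    proof -
      have "0 \<le> L * N" "0 \<le> a * N" using L a N by simp_all
      then show "\<bar>p 0\<bar> + \<bar>p 1\<bar> \<le> K * N" "\<bar>s 0\<bar> + \<bar>s 1\<bar> \<le> K * N"
        using p0 p1 s0 s1 N unfolding K_def distrib_right mult.assoc by linarith+
    qed
    have fac: "0 \<le> 1 + 1 / \<eta>" "0 \<le> (R + \<eta>) ^ k" using \<eta> R0 by auto
    have "\<bar>p k\<bar> \<le> (1 + 1 / \<eta>) * (\<bar>p 0\<bar> + \<bar>p 1\<bar>) * (R + \<eta>) ^ k"
      using recurrence_bound[of p, OF rp rad _ \<eta>] rate by (simp add: R_def)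
    also have "\<dots> \<le> (1 + 1 / \<eta>) * (K * N) * (R + \<eta>) ^ k"
      by (rule mult_right_mono[OF mult_left_mono[OF sums(1) fac(1)] fac(2)])
    finally have 1: "\<bar>p k\<bar> \<le> (1 + 1 / \<eta>) * (K * N) * (R + \<eta>) ^ k" .
    have "\<bar>s k\<bar> \<le> (1 + 1 / \<eta>) * (\<bar>s 0\<bar> + \<bar>s 1\<bar>) * (R + \<eta>) ^ k"
      using recurrence_bound[of s, OF rs rad _ \<eta>] rate by (simp add: R_def)
    also have "\<dots> \<le> (1 + 1 / \<eta>) * (K * N) * (R + \<eta>) ^ k"
      by (rule mult_right_mono[OF mult_left_mono[OF sums(2) fac(1)] fac(2)])
    finally show ?thesis using 1 by simp
  qed
  have M: "M = (1 + 1 / \<eta>) * (K * N) * (R + \<eta>) ^ k"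
    by (simp add: M_def K_def N_def R_def)
  show "\<bar>fst ((nag_op \<alpha> \<beta> ^^ k) u) \<bullet> b\<bar> \<le> M" "\<bar>snd ((nag_op \<alpha> \<beta> ^^ k) u) \<bullet> b\<bar> \<le> M"
    using main unfolding M p_def s_def A_def by simp_all
qed

lemma nag_op_power_bound:
  fixes \<mu> L a \<alpha> \<beta> \<eta> :: real
  assumes \<alpha>: "0 \<le> \<alpha>" "\<alpha> \<le> a" "\<alpha> * L \<le> 2" and \<beta>: "0 \<le> \<beta>" "\<beta> \<le> 1" and L: "0 \<le> L"
    and rate: "nag_rate \<mu> L \<alpha> \<beta> \<le> 1" and \<eta>: "0 < \<eta>"
    and spec: "\<And>b. b \<in> B \<Longrightarrow> ev b = 0 \<or> \<mu> \<le> ev b \<and> ev b \<le> L \<and> 0 \<le> ev b"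
  shows "norm ((nag_op \<alpha> \<beta> ^^ k) u)
    \<le> 2 * real (card B) * ((1 + 1 / \<eta>) * (6 + a + 3 * L)) * (nag_rate \<mu> L \<alpha> \<beta> + \<eta>) ^ k * norm u"
proof -
  define M where "M = (1 + 1 / \<eta>) * (6 + a + 3 * L) * norm u * (nag_rate \<mu> L \<alpha> \<beta> + \<eta>) ^ k"
  obtain v g where vg: "(nag_op \<alpha> \<beta> ^^ k) u = (v, g)" by (rule prod.exhaust)
  have coords: "\<bar>v \<bullet> b\<bar> \<le> M" "\<bar>g \<bullet> b\<bar> \<le> M" if "b \<in> B" for b
    using nag_op_power_coord_bound[OF \<alpha> \<beta> L rate \<eta> that spec[OF that], where k = k and u = u]
    unfolding vg M_def by simp_all
  have "norm ((nag_op \<alpha> \<beta> ^^ k) u) \<le> norm v + norm g" unfolding vg by (rule norm_Pair_le)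
  also have "\<dots> \<le> (\<Sum>b\<in>B. \<bar>v \<bullet> b\<bar>) + (\<Sum>b\<in>B. \<bar>g \<bullet> b\<bar>)" by (intro add_mono norm_le_sum_coord)
  also have "\<dots> \<le> (\<Sum>b\<in>B. M) + (\<Sum>b\<in>B. M)"
    using coords by (intro add_mono sum_mono) auto
  also have "\<dots> = 2 * real (card B) * ((1 + 1 / \<eta>) * (6 + a + 3 * L)) * (nag_rate \<mu> L \<alpha> \<beta> + \<eta>) ^ k * norm u"
    by (simp add: M_def)
  finally show ?thesis .
qed

end

section \<open>Local convergence of NAG under the PL condition\<close>

lemma linear_bound_mono:
  assumes "linear_bound x w C r" "0 \<le> r" "r \<le> r'" "C \<le> C'" "0 \<le> C"
  shows "linear_bound x w C' r'"
  unfolding linear_bound_def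
proof (intro allI impI)
  fix n :: nat assume "1 \<le> n"
  then have "norm (x n - w) \<le> C * (norm (x 1 - w) + norm (x 0 - w)) * r ^ n"
    using assms(1) by (simp add: linear_bound_def)
  also have "\<dots> \<le> C' * (norm (x 1 - w) + norm (x 0 - w)) * r' ^ n"
    using assms by (intro mult_mono power_mono mult_right_mono) auto
  finally show "norm (x n - w) \<le> C' * (norm (x 1 - w) + norm (x 0 - w)) * r' ^ n" .
qed

locale local_PL_minimum =
  eigenbasis "(*v) (hessian f z)" B ev
  for f :: "real ^ 'n \<Rightarrow> real" and z :: "real ^ 'n" and B :: "(real ^ 'n) set" and ev :: "real ^ 'n \<Rightarrow> real" +
  fixes V :: "(real ^ 'n) set" and \<nu> :: real
  assumes C2: "twice_continuously_differentiable f"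
    and V: "open V" "z \<in> V"
    and min: "y \<in> V \<Longrightarrow> f z \<le> f y"
    and \<nu>: "0 < \<nu>"
    and PL: "y \<in> V \<Longrightarrow> 2 * \<nu> * (f y - f z) \<le> (norm (gradient f y))\<^sup>2"
begin

lemmas gderiv = twice_continuously_differentiableD(1)[OF C2]

lemma critical_point_in_V:
  assumes "x \<in> V" "gradient f x = 0"
  shows "f x = f z" and "local_minimizer f x"
proof -
  have "2 * \<nu> * (f x - f z) \<le> 0" using PL[OF assms(1)] assms(2) by simp
  then have "f x \<le> f z" using \<nu> by (simp add: mult_le_0_iff)
  then show fx: "f x = f z" using min[OF assms(1)] by simp
  show "local_minimizer f x"
    unfolding local_minimizer_def using V(1) assms(1) min fx by auto
qed

text \<open>Near \<open>z\<close> gradients lie almost in the range of the Hessian at \<open>z\<close>: the gradient at \<open>x\<close> is, up to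
  a small multiple of \<open>\<bar>x - x'\<bar>\<close>, the Hessian applied to \<open>x - x'\<close> for a nearby critical point \<open>x'\<close>,
  and by the error bound \<open>\<bar>x - x'\<bar>\<close> is at most a multiple of the norm of the gradient. This replaces
  any description of the set of minimisers as a manifold.\<close>

lemma gradient_kernel_component_small:
  assumes \<delta>: "0 < \<delta>"
  obtains r where "0 < r" "\<And>x. x \<in> ball z r \<Longrightarrow> norm (ker_proj (gradient f x)) \<le> \<delta> * norm (gradient f x)"
proof -
  define c where "c = real (card B) + 1"
  have c: "0 < c" by (simp add: c_def add_nonneg_pos)
  define e where "e = \<delta> * \<nu> / (2 * c)"
  have e: "0 < e" using \<delta> \<nu> c by (simp add: e_def)
  obtain s where s: "0 < s" and strict: "\<And>x y. x \<in> ball z s \<Longrightarrow> y \<in> ball z s \<Longrightarrow>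
      norm (gradient f x - gradient f y - hessian f z *v (x - y)) \<le> e * norm (x - y)"
    by (rule gradient_strictly_differentiable[OF C2 e, of z]) blast
  obtain r where r: "0 < r" and eb: "\<And>x. x \<in> ball z r \<Longrightarrow>
      \<exists>x'\<in>ball z s. f x' = f z \<and> gradient f x' = 0 \<and> norm (x - x') \<le> 2 / \<nu> * norm (gradient f x)"
    by (rule PL_error_bound[OF gderiv V min \<nu> PL s]) (assumption | rule that)+
  show thesis
  proof (rule that[of "min r s"])
    show "0 < min r s" using r s by simp
    fix x assume x: "x \<in> ball z (min r s)"
    then obtain x' where x': "x' \<in> ball z s" "gradient f x' = 0"
      and dist: "norm (x - x') \<le> 2 / \<nu> * norm (gradient f x)"
      using eb[of x] by auto
    define w where "w = gradient f x - hessian f z *v (x - x')"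
    have w: "norm w \<le> e * norm (x - x')" using strict[of x x'] x x' by (simp add: w_def)
    have "ker_proj (gradient f x) = ker_proj w"
      unfolding w_def linear_diff[OF linear_ker_proj] by (simp add: ker_proj_T)
    also have "norm \<dots> \<le> real (card B) * norm w" by (rule norm_ker_proj_le)
    also have "\<dots> \<le> c * norm w" by (intro mult_right_mono) (auto simp: c_def)
    also have "\<dots> \<le> c * (e * norm (x - x'))" using w c by (intro mult_left_mono) auto
    also have "\<dots> \<le> c * (e * (2 / \<nu> * norm (gradient f x)))"
      using dist c e by (intro mult_left_mono) auto
    also have "\<dots> = \<delta> * norm (gradient f x)" using c \<nu> by (simp add: e_def)
    finally show "norm (ker_proj (gradient f x)) \<le> \<delta> * norm (gradient f x)" .
  qed
qed

lemma eigenvalue_nonneg: "b \<in> B \<Longrightarrow> 0 \<le> ev b"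
proof -
  assume b: "b \<in> B"
  have "0 \<le> b \<bullet> (hessian f z *v b)"
    by (rule second_order_necessary_condition[OF gderiv twice_continuously_differentiableD(2)[OF C2] V])
      (use min in blast)
  then show ?thesis using b by (simp add: eigenvector orthonormal)
qed

text \<open>If the Hessian vanished, the kernel component would be the whole gradient.\<close>

lemma locally_constant_if_hessian_zero:
  assumes zero: "\<And>b. b \<in> B \<Longrightarrow> ev b = 0"
  shows "\<exists>W. open W \<and> z \<in> W \<and> (\<forall>y\<in>W. f y = f z)"
proof -
  have id: "ker_proj w = w" for w by (rule eq_if_coords_eq) (simp add: coord_ker_proj zero)
  obtain r where r: "0 < r"
    and ker: "\<And>x. x \<in> ball z r \<Longrightarrow> norm (ker_proj (gradient f x)) \<le> 1 / 2 * norm (gradient f x)"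
    by (rule gradient_kernel_component_small[of "1 / 2"]) (simp, blast)
  have grad: "gradient f x = 0" if "x \<in> ball z r" for x
  proof -
    have "norm (gradient f x) \<le> 1 / 2 * norm (gradient f x)" using ker[OF that] by (simp only: id)
    then have "norm (gradient f x) \<le> 0" by linarith
    then show ?thesis by simp
  qed
  have "\<forall>y\<in>ball z r \<inter> V. f y = f z"
  proof
    fix y assume "y \<in> ball z r \<inter> V"
    then show "f y = f z" by (intro critical_point_in_V(1) grad) simp_all
  qed
  moreover have "open (ball z r \<inter> V)" "z \<in> ball z r \<inter> V" using r V by (simp_all add: open_Int)
  ultimately show ?thesis by blast
qed

lemma nag_op_step_error:
  assumes \<alpha>: "0 \<le> \<alpha>" "\<alpha> \<le> a" and \<beta>: "0 \<le> \<beta>" "\<beta> \<le> 1" and \<delta>: "0 \<le> \<delta>"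
    and strict: "norm (gradient f y' - gradient f y - hessian f z *v (y' - y)) \<le> \<delta> * norm (y' - y)"
    and ker: "norm (ker_proj (gradient f y)) \<le> \<delta> * norm (gradient f y)"
    and v': "v' = \<beta> *\<^sub>R v - \<alpha> *\<^sub>R gradient f y" and y': "y' - y = (1 + \<beta>) *\<^sub>R v' - \<beta> *\<^sub>R v"
  shows "norm ((v', gradient f y') - nag_op \<alpha> \<beta> (v, gradient f y))
    \<le> (4 + 3 * a) * \<delta> * norm (v, gradient f y)"
proof -
  define g q N where "g = gradient f y" and "q = ker_proj g" and "N = norm (v, g)"
  have vN: "norm v \<le> N" and gN: "norm g \<le> N"
    unfolding N_def by (rule norm_fst_le, rule norm_snd_le)
  have a: "0 \<le> a" using \<alpha> by simp
  have qN: "norm q \<le> \<delta> * N"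
    using ker mult_left_mono[OF gN \<delta>] unfolding q_def g_def by linarith
  define w where "w = \<beta> *\<^sub>R v - \<alpha> *\<^sub>R (g - q)"
  have w: "w = v' + \<alpha> *\<^sub>R q" by (simp add: w_def v' g_def algebra_simps)
  have Tw: "hessian f z *v ((1 + \<beta>) *\<^sub>R w - \<beta> *\<^sub>R v) = hessian f z *v (y' - y)"
  proof -
    have "(1 + \<beta>) *\<^sub>R w - \<beta> *\<^sub>R v = (y' - y) + ((1 + \<beta>) * \<alpha>) *\<^sub>R q"
      unfolding y' w by (simp add: algebra_simps)
    then show ?thesis
      by (simp add: linear_add[OF linear] linear_scale[OF linear] q_def T_ker_proj)
  qed
  have op: "nag_op \<alpha> \<beta> (v, g) = (w, (g - q) + hessian f z *v (y' - y))"
    using Tw by (simp add: nag_op_def Let_def q_def w_def)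
  have "(v', gradient f y') - nag_op \<alpha> \<beta> (v, g)
      = (- (\<alpha> *\<^sub>R q), (gradient f y' - g - hessian f z *v (y' - y)) + q)"
    unfolding op w by simp
  then have "norm ((v', gradient f y') - nag_op \<alpha> \<beta> (v, g))
      \<le> norm (- (\<alpha> *\<^sub>R q)) + norm ((gradient f y' - g - hessian f z *v (y' - y)) + q)"
    by (simp only: norm_Pair_le)
  also have "\<dots> \<le> \<alpha> * norm q + (norm (gradient f y' - g - hessian f z *v (y' - y)) + norm q)"
    using \<alpha> by (intro add_mono norm_triangle_ineq) simp
  also have "\<dots> \<le> a * (\<delta> * N) + (\<delta> * ((3 + 2 * a) * N) + \<delta> * N)"
  proof (intro add_mono)
    show "\<alpha> * norm q \<le> a * (\<delta> * N)" using \<alpha> qN a by (intro mult_mono) auto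
    show "norm q \<le> \<delta> * N" by (rule qN)
    have "norm v' \<le> \<beta> * norm v + \<alpha> * norm g"
      unfolding v' g_def using norm_triangle_ineq4[of "\<beta> *\<^sub>R v" "\<alpha> *\<^sub>R gradient f y"] \<alpha> \<beta> by simp
    also have "\<dots> \<le> 1 * N + a * N" using \<alpha> \<beta> vN gN a by (intro add_mono mult_mono) auto
    finally have v'N: "norm v' \<le> N + a * N" by simp
    have "norm (y' - y) \<le> (1 + \<beta>) * norm v' + \<beta> * norm v"
      unfolding y' using norm_triangle_ineq4[of "(1 + \<beta>) *\<^sub>R v'" "\<beta> *\<^sub>R v"] \<beta> by simp
    also have "\<dots> \<le> 2 * (N + a * N) + 1 * N" using \<beta> vN v'N by (intro add_mono mult_mono) auto
    finally have "norm (y' - y) \<le> (3 + 2 * a) * N" by (simp add: algebra_simps)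
    then have "\<delta> * norm (y' - y) \<le> \<delta> * ((3 + 2 * a) * N)" using \<delta> by (rule mult_left_mono)
    then show "norm (gradient f y' - g - hessian f z *v (y' - y)) \<le> \<delta> * ((3 + 2 * a) * N)"
      using strict unfolding g_def by linarith
  qed
  also have "\<dots> = (4 + 3 * a) * \<delta> * N" by (simp add: algebra_simps)
  finally show ?thesis by (simp add: g_def N_def)
qed

text \<open>The state of the iteration is the pair of the increment \<open>x\<^sub>n\<^sub>+\<^sub>1 - x\<^sub>n\<close> and the gradient at the
  extrapolated point. As long as the iterates stay near \<open>z\<close>, it is a small perturbation of the
  linear operator \<open>nag_op\<close>, so it decays geometrically; the increments are then summable, which in
  turn keeps the iterates near \<open>z\<close> and produces the limit. All constants depend only on \<open>f\<close>, \<open>z\<close>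
  and \<open>\<epsilon>\<close>, not on \<open>\<alpha>\<close> and \<open>\<beta>\<close>.\<close>

theorem nag_local_linear_convergence:
  fixes \<mu> L \<epsilon> :: real
  assumes \<mu>: "0 < \<mu>" "\<mu> \<le> L" and \<epsilon>: "0 < \<epsilon>"
    and spec: "\<And>b. b \<in> B \<Longrightarrow> ev b = 0 \<or> \<mu> \<le> ev b \<and> ev b \<le> L"
  obtains U C where "open U" "z \<in> U" "0 < C"
    "\<And>x0 x1 \<alpha> \<beta>. \<lbrakk>x0 \<in> U; x1 \<in> U; 0 < \<alpha>; \<alpha> * L \<le> 2; 0 \<le> \<beta>; \<beta> < 1; nag_rate \<mu> L \<alpha> \<beta> + \<epsilon> \<le> 1\<rbrakk> \<Longrightarrow>
      \<exists>x'. local_minimizer f x' \<and> f x' = f z \<and>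
        linear_bound (nag f \<alpha> \<beta> x0 x1) x' C (nag_rate \<mu> L \<alpha> \<beta> + \<epsilon>)"
proof -
  have spec': "ev b = 0 \<or> \<mu> \<le> ev b \<and> ev b \<le> L \<and> 0 \<le> ev b" if "b \<in> B" for b
    using spec[OF that] eigenvalue_nonneg[OF that] by blast
  define g where "g = gradient f"
  define a where "a = 2 / L"
  define \<eta> where "\<eta> = \<epsilon> / 4"
  define C1 where "C1 = 2 * real (card B) * ((1 + 1 / \<eta>) * (6 + a + 3 * L))"
  \<comment> \<open>With the relative error \<open>\<delta>'\<close> the perturbation costs at most another \<open>\<eta>\<close> in the rate.\<close>
  define \<delta>' where "\<delta>' = \<eta> / (C1 + 1)"
  define \<delta> where "\<delta> = \<delta>' / (4 + 3 * a)"
  have L: "0 < L" and a: "0 < a" and \<eta>: "0 < \<eta>" using \<mu> \<epsilon> by (auto simp: a_def \<eta>_def)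
  have C1: "0 \<le> C1" using \<eta> a L by (auto simp: C1_def)
  have \<delta>': "0 < \<delta>'" using \<eta> C1 by (simp add: \<delta>'_def)
  have C1\<delta>: "C1 * \<delta>' \<le> \<eta>" using C1 \<eta> by (simp add: \<delta>'_def field_simps)
  have \<delta>: "0 < \<delta>" and \<delta>\<delta>': "(4 + 3 * a) * \<delta> = \<delta>'" using \<delta>' a by (auto simp: \<delta>_def)
  obtain r1 where r1: "0 < r1" and strict1: "\<And>x y. x \<in> ball z r1 \<Longrightarrow> y \<in> ball z r1 \<Longrightarrow>
      norm (g x - g y - hessian f z *v (x - y)) \<le> \<delta> * norm (x - y)"
    unfolding g_def by (rule gradient_strictly_differentiable[OF C2 \<delta>, of z]) blast
  obtain r2 where r2: "0 < r2" and ker2: "\<And>x. x \<in> ball z r2 \<Longrightarrow> norm (ker_proj (g x)) \<le> \<delta> * norm (g x)"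
    unfolding g_def by (rule gradient_kernel_component_small[OF \<delta>]) blast
  obtain r3 where r3: "0 < r3" "ball z r3 \<subseteq> V" using V open_contains_ball by blast
  define r where "r = min r1 (min r2 r3)"
  have r: "0 < r" using r1 r2 r3 by (simp add: r_def)
  have strict: "norm (g x - g y - hessian f z *v (x - y)) \<le> \<delta> * norm (x - y)"
    if "x \<in> ball z r" "y \<in> ball z r" for x y using strict1[of x y] that by (auto simp: r_def)
  have ker: "norm (ker_proj (g x)) \<le> \<delta> * norm (g x)" if "x \<in> ball z r" for x
    using ker2[of x] that by (auto simp: r_def)
  have rV: "ball z r \<subseteq> V" using r3 by (auto simp: r_def)
  have gz: "g z = 0" unfolding g_def by (rule gradient_zero_at_minimum[OF gderiv V]) (use min in blast)
  \<comment> \<open>A Lipschitz constant of the gradient near \<open>z\<close>.\<close>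
  obtain K where K: "0 < K" and Kb: "\<And>w. norm (hessian f z *v w) \<le> K * norm w"
    using linear_bounded_pos[OF linear] by blast
  define \<Lambda> where "\<Lambda> = K + \<delta>"
  have \<Lambda>: "0 < \<Lambda>" using K \<delta> by (simp add: \<Lambda>_def)
  have lip: "norm (g x - g y) \<le> \<Lambda> * norm (x - y)" if "x \<in> ball z r" "y \<in> ball z r" for x y
  proof -
    have "norm (g x - g y) \<le> norm (g x - g y - hessian f z *v (x - y)) + norm (hessian f z *v (x - y))"
      using norm_triangle_ineq[of "g x - g y - hessian f z *v (x - y)" "hessian f z *v (x - y)"] by simp
    also have "\<dots> \<le> \<delta> * norm (x - y) + K * norm (x - y)" by (intro add_mono strict[OF that] Kb)
    finally show ?thesis by (simp add: \<Lambda>_def algebra_simps)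
  qed
  \<comment> \<open>Iterates within \<open>s\<close> of \<open>z\<close> keep the extrapolated points within \<open>r\<close>.\<close>
  define s where "s = r / 4"
  have s: "0 < s" using r by (simp add: s_def)
  \<comment> \<open>Starting within \<open>t\<close> of \<open>z\<close>, the iterates travel a total distance of at most \<open>Q t\<close>.\<close>
  define Q where "Q = (1 + a) * C1 * (2 + 3 * \<Lambda>) * (2 / \<epsilon>)"
  have Q: "0 \<le> Q" using a C1 \<Lambda> \<epsilon> by (simp add: Q_def)
  define t where "t = s / (2 * (1 + Q))"
  have t: "0 < t" "t + Q * t < s" "t < s"
  proof -
    show "0 < t" using s Q by (simp add: t_def)
    have "t * (2 * (1 + Q)) = s" using Q by (simp add: t_def)
    then have double: "(t + Q * t) + (t + Q * t) = s" by (simp add: algebra_simps)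
    have "0 \<le> Q * t" using Q \<open>0 < t\<close> by simp
    then show "t + Q * t < s" "t < s" using double \<open>0 < t\<close> by linarith+
  qed
  define C where "C = (1 + a) * C1 * (1 + 2 * \<Lambda>) * (2 / \<epsilon>) * (2 / \<epsilon>) + 1"
  have C: "0 < C" using a C1 \<Lambda> \<epsilon> by (simp add: C_def add_nonneg_pos)
  show thesis
  proof (rule that[of "ball z t" C])
    show "open (ball z t)" "z \<in> ball z t" "0 < C" using t C by auto
    fix x0 x1 :: "real ^ 'n" and \<alpha> \<beta> :: real
    assume x0: "x0 \<in> ball z t" and x1: "x1 \<in> ball z t" and \<alpha>: "0 < \<alpha>" "\<alpha> * L \<le> 2"
      and \<beta>: "0 \<le> \<beta>" "\<beta> < 1" and rate: "nag_rate \<mu> L \<alpha> \<beta> + \<epsilon> \<le> 1"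
    define R where "R = nag_rate \<mu> L \<alpha> \<beta>"
    define \<theta> where "\<theta> = R + 2 * \<eta>"
    have R: "0 \<le> R" using \<beta> by (simp add: R_def nag_rate_def)
    have \<theta>: "\<epsilon> / 2 \<le> \<theta>" "\<theta> \<le> 1 - \<epsilon> / 2" "\<theta> \<le> R + \<epsilon>"
      using R rate \<epsilon> by (auto simp: \<theta>_def \<eta>_def R_def)
    have \<theta>01: "0 < \<theta>" "\<theta> < 1" using \<theta> \<epsilon> by linarith+
    have \<alpha>a: "\<alpha> \<le> a" using \<alpha> L by (simp add: a_def field_simps)
    define x where "x = nag f \<alpha> \<beta> x0 x1"
    define X where "X n = x (Suc n)" for n
    define v where "v n = x (Suc n) - x n" for n
    define y where "y n = x (Suc n) + \<beta> *\<^sub>R v n" for n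
    define u where "u n = (v n, g (y n))" for n
    have x01: "x 0 = x0" "x 1 = x1" by (simp_all add: x_def)
    have xS: "x (Suc (Suc n)) = y n - \<alpha> *\<^sub>R g (y n)" for n
      by (simp add: x_def y_def v_def g_def Let_def)
    have vS: "v (Suc n) = \<beta> *\<^sub>R v n - \<alpha> *\<^sub>R g (y n)" for n
      by (simp add: v_def[of "Suc n"] xS y_def)
    have yS: "y (Suc n) - y n = (1 + \<beta>) *\<^sub>R v (Suc n) - \<beta> *\<^sub>R v n" for n
      unfolding y_def by (simp add: v_def[of "Suc n"] algebra_simps)
    have near0: "norm (x0 - z) < t" "norm (x1 - z) < t"
      using x0 x1 by (auto simp: dist_norm norm_minus_commute)
    have y_near: "y n \<in> ball z r" if "norm (x n - z) < s" "norm (x (Suc n) - z) < s" for n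
    proof -
      have "y n - z = (1 + \<beta>) *\<^sub>R (x (Suc n) - z) - \<beta> *\<^sub>R (x n - z)"
        by (simp add: y_def v_def algebra_simps)
      then have "norm (y n - z) \<le> (1 + \<beta>) * norm (x (Suc n) - z) + \<beta> * norm (x n - z)"
        using norm_triangle_ineq4[of "(1 + \<beta>) *\<^sub>R (x (Suc n) - z)" "\<beta> *\<^sub>R (x n - z)"] \<beta> by simp
      also have "\<dots> \<le> 2 * s + 1 * s" using that \<beta> by (intro add_mono mult_mono) auto
      also have "\<dots> < r" using r by (simp add: s_def)
      finally show ?thesis by (simp add: dist_norm norm_minus_commute)
    qed
    have u_bound: "norm (u n) \<le> C1 * \<theta> ^ n * norm (u 0)"
      if near: "\<And>k. k \<le> n \<Longrightarrow> norm (X k - z) < s" for n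
    proof -
      have ynear: "y k \<in> ball z r" if "k \<le> n" for k
      proof (rule y_near)
        show "norm (x (Suc k) - z) < s" using near[OF that] by (simp add: X_def)
        show "norm (x k - z) < s"
        proof (cases k)
          case 0
          then show ?thesis using near0(1) t(3) x01 by simp
        next
          case (Suc j)
          then show ?thesis using near[of j] that by (simp add: X_def)
        qed
      qed
      have "norm (u n) \<le> C1 * (R + \<eta> + C1 * \<delta>') ^ n * norm (u 0)"
      proof (rule perturbed_power_bound[where A = "nag_op \<alpha> \<beta>" and N = n])
        show "linear (nag_op \<alpha> \<beta>)" by (rule linear_nag_op)
        show "norm ((nag_op \<alpha> \<beta> ^^ k) w) \<le> C1 * (R + \<eta>) ^ k * norm w" for k w
          unfolding C1_def R_def
          using rate \<epsilon> by (intro nag_op_power_bound \<alpha> \<alpha>a \<beta> \<eta> spec' less_imp_le[OF \<alpha>(1)]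
              less_imp_le[OF \<beta>(2)] less_imp_le[OF L]) simp_all
        show "norm (u (Suc m) - nag_op \<alpha> \<beta> (u m)) \<le> \<delta>' * norm (u m)" if "m < n" for m
        proof -
          have ym: "y m \<in> ball z r" "y (Suc m) \<in> ball z r" using ynear that by auto
          have "norm (g (y (Suc m)) - g (y m) - hessian f z *v (y (Suc m) - y m)) \<le> \<delta> * norm (y (Suc m) - y m)"
            "norm (ker_proj (g (y m))) \<le> \<delta> * norm (g (y m))"
            by (rule strict[OF ym(2,1)], rule ker[OF ym(1)])
          then have "norm ((v (Suc m), g (y (Suc m))) - nag_op \<alpha> \<beta> (v m, g (y m)))
              \<le> (4 + 3 * a) * \<delta> * norm (v m, g (y m))"
            using \<alpha>(1) \<alpha>a \<beta> \<delta> vS[of m] yS[of m] unfolding g_def by (intro nag_op_step_error) simp_all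
          then show ?thesis unfolding u_def \<delta>\<delta>' .
        qed
      qed (use C1 R \<eta> \<delta>' in auto)
      also have "\<dots> \<le> C1 * \<theta> ^ n * norm (u 0)"
        using C1 C1\<delta> R \<eta> \<delta>' by (intro mult_right_mono mult_left_mono power_mono) (auto simp: \<theta>_def)
      finally show ?thesis .
    qed
    define D where "D = (1 + a) * C1 * norm (u 0)"
    have D: "0 \<le> D" using a C1 by (simp add: D_def)
    have step: "norm (X (Suc n) - X n) \<le> D * \<theta> ^ n"
      if near: "\<And>k. k \<le> n \<Longrightarrow> norm (X k - z) < s" for n
    proof -
      have vu: "norm (v n) \<le> norm (u n)" and gu: "norm (g (y n)) \<le> norm (u n)"
        unfolding u_def by (rule norm_fst_le, rule norm_snd_le)
      have "norm (X (Suc n) - X n) = norm (\<beta> *\<^sub>R v n - \<alpha> *\<^sub>R g (y n))"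
        unfolding vS[symmetric] by (simp add: X_def v_def)
      also have "\<dots> \<le> \<beta> * norm (v n) + \<alpha> * norm (g (y n))"
        using norm_triangle_ineq4[of "\<beta> *\<^sub>R v n" "\<alpha> *\<^sub>R g (y n)"] \<alpha> \<beta> by simp
      also have "\<dots> \<le> 1 * norm (u n) + a * norm (u n)"
        using \<alpha> \<alpha>a \<beta> vu gu by (intro add_mono mult_mono) auto
      also have "\<dots> = (1 + a) * norm (u n)" by (simp add: algebra_simps)
      also have "\<dots> \<le> (1 + a) * (C1 * \<theta> ^ n * norm (u 0))"
        using a by (intro mult_left_mono u_bound near) auto
      finally show ?thesis by (simp add: D_def mult.commute mult.left_commute)
    qed
    have inv\<theta>: "1 / (1 - \<theta>) \<le> 2 / \<epsilon>" "1 / \<theta> \<le> 2 / \<epsilon>"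
      using \<theta> \<theta>01 \<epsilon> by (auto simp: field_simps)
    have y0: "y 0 \<in> ball z r" using near0 t x01 by (intro y_near) auto
    have u0: "norm (u 0) \<le> (2 + 3 * \<Lambda>) * t"
    proof -
      have "norm (v 0) \<le> norm (x1 - z) + norm (x0 - z)"
        using norm_triangle_ineq4[of "x1 - z" "x0 - z"] x01 by (simp add: v_def)
      then have v0: "norm (v 0) \<le> 2 * t" using near0 by linarith
      have "norm (y 0 - z) \<le> norm (x1 - z) + \<beta> * norm (v 0)"
        using norm_triangle_ineq[of "x1 - z" "\<beta> *\<^sub>R v 0"] x01 \<beta> by (simp add: y_def algebra_simps)
      also have "\<dots> \<le> t + 1 * (2 * t)" using near0 v0 \<beta> t by (intro add_mono mult_mono) auto
      finally have y0z: "norm (y 0 - z) \<le> 3 * t" by simp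
      have "norm (g (y 0)) \<le> \<Lambda> * norm (y 0 - z)" using lip[OF y0, of z] r gz by simp
      also have "\<dots> \<le> \<Lambda> * (3 * t)" using y0z \<Lambda> by (intro mult_left_mono) auto
      finally have "norm (g (y 0)) \<le> \<Lambda> * (3 * t)" .
      moreover have "norm (u 0) \<le> norm (v 0) + norm (g (y 0))" unfolding u_def by (rule norm_Pair_le)
      ultimately show ?thesis using v0 by (simp add: algebra_simps)
    qed
    have D1: "D / (1 - \<theta>) \<le> D * (2 / \<epsilon>)"
      using mult_left_mono[OF inv\<theta>(1) D] by simp
    have "D * (2 / \<epsilon>) \<le> Q * t"
    proof -
      have "D \<le> (1 + a) * C1 * ((2 + 3 * \<Lambda>) * t)"
        unfolding D_def using a C1 by (intro mult_left_mono u0) auto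
      then have "D * (2 / \<epsilon>) \<le> (1 + a) * C1 * ((2 + 3 * \<Lambda>) * t) * (2 / \<epsilon>)"
        using \<epsilon> by (intro mult_right_mono) auto
      then show ?thesis by (simp add: Q_def mult.commute mult.left_commute)
    qed
    then have start: "norm (X 0 - z) + D / (1 - \<theta>) < s"
      using D1 near0(2) t(2) x01 by (simp add: X_def)
    obtain x' where Xnear: "\<And>n. norm (X n - z) < s" and lim: "X \<longlonglongrightarrow> x'"
      and Xbound: "\<And>n. norm (X n - x') \<le> D * \<theta> ^ n / (1 - \<theta>)"
      using confined_geometric_sequence[OF less_imp_le[OF \<theta>01(1)] \<theta>01(2) D start step] by blast
    have "norm (x' - z) \<le> s"
    proof (rule LIMSEQ_le_const2)
      show "(\<lambda>n. norm (X n - z)) \<longlonglongrightarrow> norm (x' - z)" by (intro tendsto_intros lim)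
      show "\<exists>N. \<forall>n\<ge>N. norm (X n - z) \<le> s" using Xnear less_imp_le by blast
    qed
    then have x'r: "x' \<in> ball z r" using r by (simp add: s_def dist_norm norm_minus_commute)
    \<comment> \<open>The limit is a critical point, hence a minimiser by the PL inequality.\<close>
    have gx': "g x' = 0"
    proof -
      have lim1: "(\<lambda>n. X (Suc n)) \<longlonglongrightarrow> x'" using lim by (rule LIMSEQ_Suc)
      have "(\<lambda>n. X (Suc n) + \<beta> *\<^sub>R (X (Suc n) - X n)) \<longlonglongrightarrow> x' + \<beta> *\<^sub>R (x' - x')"
        by (intro tendsto_intros lim lim1)
      then have ylim: "(\<lambda>n. y (Suc n)) \<longlonglongrightarrow> x'" by (simp add: y_def v_def X_def)
      have "isCont g x'"
        unfolding g_def using twice_continuously_differentiableD(2)[OF C2] by (rule has_derivative_continuous)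
      then have glim: "(\<lambda>n. g (y (Suc n))) \<longlonglongrightarrow> g x'" using ylim by (rule isCont_tendsto_compose)
      have "(\<lambda>n. g (y (Suc n))) \<longlonglongrightarrow> 0"
      proof (rule Lim_null_comparison)
        have "norm (g (y n)) \<le> C1 * \<theta> ^ n * norm (u 0)" for n
          using u_bound[of n, OF Xnear] norm_snd_le[of "g (y n)" "v n"] unfolding u_def by linarith
        then show "\<forall>\<^sub>F n in sequentially. norm (g (y (Suc n))) \<le> C1 * \<theta> ^ Suc n * norm (u 0)"
          by (intro always_eventually allI)
        have "(\<lambda>n. \<theta> ^ Suc n) \<longlonglongrightarrow> 0"
          using \<theta>01 by (intro LIMSEQ_Suc LIMSEQ_power_zero) auto
        then have "(\<lambda>n. C1 * \<theta> ^ Suc n * norm (u 0)) \<longlonglongrightarrow> C1 * 0 * norm (u 0)"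
          by (intro tendsto_intros)
        then show "(\<lambda>n. C1 * \<theta> ^ Suc n * norm (u 0)) \<longlonglongrightarrow> 0" by simp
      qed
      with glim show ?thesis by (rule LIMSEQ_unique)
    qed
    define S where "S = norm (x 1 - x') + norm (x 0 - x')"
    have S: "0 \<le> S" by (simp add: S_def)
    have u0S: "norm (u 0) \<le> (1 + 2 * \<Lambda>) * S"
    proof -
      have v0: "norm (v 0) \<le> S"
        using norm_triangle_ineq4[of "x 1 - x'" "x 0 - x'"] by (simp add: v_def S_def)
      have "norm (y 0 - x') \<le> norm (x 1 - x') + \<beta> * norm (v 0)"
        using norm_triangle_ineq[of "x 1 - x'" "\<beta> *\<^sub>R v 0"] \<beta> by (simp add: y_def algebra_simps)
      also have "\<dots> \<le> S + 1 * S" using v0 \<beta> S by (intro add_mono mult_mono) (auto simp: S_def)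
      finally have y0x': "norm (y 0 - x') \<le> 2 * S" by simp
      have "norm (g (y 0)) \<le> \<Lambda> * norm (y 0 - x')" using lip[OF y0 x'r] gx' by simp
      also have "\<dots> \<le> \<Lambda> * (2 * S)" using y0x' \<Lambda> by (intro mult_left_mono) auto
      finally have "norm (g (y 0)) \<le> \<Lambda> * (2 * S)" .
      moreover have "norm (u 0) \<le> norm (v 0) + norm (g (y 0))" unfolding u_def by (rule norm_Pair_le)
      ultimately show ?thesis using v0 by (simp add: algebra_simps)
    qed
    have DS: "D * (2 / \<epsilon>) * (2 / \<epsilon>) \<le> C * S"
    proof -
      have "D \<le> (1 + a) * C1 * ((1 + 2 * \<Lambda>) * S)"
        unfolding D_def using a C1 by (intro mult_left_mono u0S) auto
      then have "D * ((2 / \<epsilon>) * (2 / \<epsilon>)) \<le> (1 + a) * C1 * ((1 + 2 * \<Lambda>) * S) * ((2 / \<epsilon>) * (2 / \<epsilon>))"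
        using \<epsilon> by (intro mult_right_mono) auto
      also have "\<dots> = (C - 1) * S" by (simp add: C_def mult.commute mult.left_commute)
      also have "\<dots> \<le> C * S" using S by (simp add: algebra_simps)
      finally show ?thesis by (simp add: mult.assoc)
    qed
    have "linear_bound x x' C \<theta>"
      unfolding linear_bound_def
    proof (intro allI impI)
      fix n :: nat assume "1 \<le> n"
      then obtain m where m: "n = Suc m" by (cases n) auto
      have "norm (x n - x') \<le> D * \<theta> ^ m / (1 - \<theta>)" using Xbound[of m] by (simp add: X_def m)
      also have "\<dots> = (D / (1 - \<theta>)) * \<theta> ^ m" by simp
      also have "\<dots> \<le> (D * (2 / \<epsilon>)) * \<theta> ^ m" using D1 \<theta>01 by (intro mult_right_mono) auto
      also have "\<dots> = (D * (2 / \<epsilon>)) * (1 / \<theta>) * \<theta> ^ n" using \<theta>01 by (simp add: m)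
      also have "\<dots> \<le> (D * (2 / \<epsilon>)) * (2 / \<epsilon>) * \<theta> ^ n"
        using inv\<theta>(2) D \<epsilon> \<theta>01 by (intro mult_right_mono mult_left_mono) auto
      also have "\<dots> \<le> (C * S) * \<theta> ^ n" using DS \<theta>01 by (intro mult_right_mono) auto
      finally show "norm (x n - x') \<le> C * (norm (x 1 - x') + norm (x 0 - x')) * \<theta> ^ n"
        by (simp add: S_def)
    qed
    then have "linear_bound x x' C (nag_rate \<mu> L \<alpha> \<beta> + \<epsilon>)"
      by (rule linear_bound_mono) (use \<theta> \<theta>01 C in \<open>auto simp: R_def\<close>)
    moreover have "x' \<in> V" using x'r rV by blast
    ultimately show "\<exists>x'. local_minimizer f x' \<and> f x' = f z \<and>
        linear_bound (nag f \<alpha> \<beta> x0 x1) x' C (nag_rate \<mu> L \<alpha> \<beta> + \<epsilon>)"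
      using critical_point_in_V[of x'] gx' unfolding g_def x_def by (intro exI[of _ x'] conjI) simp_all
  qed
qed

end

section \<open>Optimality on quadratic problems\<close>

lemma symmetric_matrix_self_adjoint:
  fixes A :: "real ^ 'n ^ 'n"
  assumes "transpose A = A"
  shows "(A *v x) \<bullet> y = x \<bullet> (A *v y)"
  by (metis assms dot_lmul_matrix transpose_matrix_vector)

lemma self_adjoint_matrix_symmetric:
  fixes A :: "real ^ 'n ^ 'n"
  assumes "\<And>x y. (A *v x) \<bullet> y = x \<bullet> (A *v y)"
  shows "transpose A = A"
proof -
  have "\<forall>y. (transpose A *v x) \<bullet> y = (A *v x) \<bullet> y" for x
    by (simp add: assms transpose_matrix_vector dot_lmul_matrix)
  then have "transpose A *v x = A *v x" for x by (rule iffD1[OF vector_eq_rdot])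
  then show ?thesis by (intro iffD2[OF matrix_eq] allI)
qed

lemma eigenvalues_eigenbasis:
  assumes "eigenbasis ((*v) A) B ev"
  shows "eigenvalues A = ev ` B"
  using eigenbasis.eigenvalue_iff[OF assms] by (auto simp: eigenvalues_def)

lemma symmetric_matrix_eigenbasis:
  fixes A :: "real ^ 'n ^ 'n"
  assumes "transpose A = A"
  obtains B ev where "eigenbasis ((*v) A) B ev"
  using eigenbasis_exists[OF matrix_vector_mul_linear symmetric_matrix_self_adjoint[OF assms]] .

lemma quadratic_GDERIV:
  fixes A :: "real ^ 'n ^ 'n"
  assumes "transpose A = A"
  shows "GDERIV (\<lambda>x. 1/2 * (x \<bullet> (A *v x)) + b \<bullet> x + c) x :> A *v x + b"
proof -
  have "((\<lambda>x. 1/2 * (x \<bullet> (A *v x)) + b \<bullet> x + c) has_derivative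
      (\<lambda>h. 1/2 * (x \<bullet> (A *v h) + h \<bullet> (A *v x)) + b \<bullet> h + 0)) (at x)"
    by (intro derivative_intros has_derivative_mult_right bounded_linear.has_derivative[OF matrix_vector_mul_bounded_linear])
  moreover have "1/2 * (x \<bullet> (A *v h) + h \<bullet> (A *v x)) + b \<bullet> h + 0 = h \<bullet> (A *v x + b)" for h
    using symmetric_matrix_self_adjoint[OF assms, of x h] by (simp add: inner_add_right inner_commute)
  ultimately show ?thesis unfolding gderiv_def by simp
qed

lemma nag_contraction_factor_quadratic:
  assumes \<alpha>: "0 \<le> \<alpha>" and \<beta>: "0 \<le> \<beta>" and rate: "nag_rate \<mu> L \<alpha> \<beta> \<le> 1"
  shows "nag_contraction_factor (quadratic_problems \<mu> L :: (real ^ 'n \<Rightarrow> real) set) \<alpha> \<beta> (nag_rate \<mu> L \<alpha> \<beta>)"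
  unfolding nag_contraction_factor_def
proof (intro conjI ballI allI impI)
  show "0 \<le> nag_rate \<mu> L \<alpha> \<beta>" using \<beta> by (simp add: nag_rate_def)
  fix q :: "real ^ 'n \<Rightarrow> real" and \<epsilon> :: real
  assume "q \<in> quadratic_problems \<mu> L" and \<epsilon>: "0 < \<epsilon>"
  then obtain A b c where q: "q = (\<lambda>x. 1/2 * (x \<bullet> (A *v x)) + b \<bullet> x + c)" and A: "transpose A = A"
    and ext: "Min (eigenvalues A) = \<mu>" "Max (eigenvalues A) = L"
    unfolding quadratic_problems_def by blast
  obtain B ev where "eigenbasis ((*v) A) B ev" using symmetric_matrix_eigenbasis[OF A] .
  then interpret eigenbasis "(*v) A" B ev .
  have E: "eigenvalues A = ev ` B" by (rule eigenvalues_eigenbasis) unfold_locales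
  have ev: "\<mu> \<le> ev e" "ev e \<le> L" if "e \<in> B" for e
    using ext[symmetric] that finite unfolding E by simp_all
  have grad: "gradient q x = A *v x + b" for x
    unfolding q by (intro gradient_eqI quadratic_GDERIV A)
  define R where "R = nag_rate \<mu> L \<alpha> \<beta>"
  define C where "C = real (card B) * (1 + 1 / \<epsilon>) + 1"
  have C: "0 < C" using \<epsilon> by (simp add: C_def add_nonneg_pos)
  have "linear_bound (nag q \<alpha> \<beta> x0 x1) z C (R + \<epsilon>)" if z: "\<forall>y. q z \<le> q y" for x0 x1 z
    unfolding linear_bound_def
  proof (intro allI impI)
    define x where "x = nag q \<alpha> \<beta> x0 x1"
    define S where "S = norm (x 1 - z) + norm (x 0 - z)"
    fix n :: nat
    have "GDERIV q z :> A *v z + b" unfolding q by (rule quadratic_GDERIV[OF A])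
    then have "A *v z + b = 0" by (rule gradient_zero_at_minimum[of q z _ UNIV]) (use z in auto)
    then have b: "b = - (A *v z)" by (simp add: eq_neg_iff_add_eq_0 add.commute)
    have coord: "\<bar>(x n - z) \<bullet> e\<bar> \<le> (1 + 1 / \<epsilon>) * S * (R + \<epsilon>) ^ n" if e: "e \<in> B" for e
    proof -
      define t where "t k = (x k - z) \<bullet> e" for k
      define d where "d = 1 - \<alpha> * ev e"
      have rec: "t (Suc (Suc k)) = ((1 + \<beta>) * d) * t (Suc k) - (\<beta> * d) * t k" for k
      proof -
        define y where "y = x (Suc k) + \<beta> *\<^sub>R (x (Suc k) - x k)"
        have "x (Suc (Suc k)) = y - \<alpha> *\<^sub>R gradient q y"
          by (simp add: x_def y_def Let_def)
        then have "x (Suc (Suc k)) - z = (y - z) - \<alpha> *\<^sub>R (A *v (y - z))"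
          by (simp add: grad b matrix_vector_mult_diff_distrib)
        then have "t (Suc (Suc k)) = (y - z) \<bullet> e - \<alpha> * (ev e * ((y - z) \<bullet> e))"
          by (simp only: t_def inner_diff_left inner_scaleR_left coord_T[OF e])
        also have "\<dots> = d * ((y - z) \<bullet> e)" by (simp add: d_def algebra_simps)
        also have "(y - z) \<bullet> e = (1 + \<beta>) * t (Suc k) - \<beta> * t k"
          by (simp add: y_def t_def inner_diff_left inner_add_left algebra_simps)
        finally show ?thesis by (simp add: algebra_simps)
      qed
      have rad: "root_radius ((1 + \<beta>) * d) (\<beta> * d) \<le> R"
        unfolding d_def mode_radius_def[symmetric] R_def by (rule mode_radius_le_nag_rate[OF \<beta> \<alpha> ev[OF e]])
      have "\<bar>t n\<bar> \<le> (1 + 1 / \<epsilon>) * (\<bar>t 0\<bar> + \<bar>t 1\<bar>) * (R + \<epsilon>) ^ n"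
        using recurrence_bound[of t, OF rec rad _ \<epsilon>] rate by (simp add: R_def)
      also have "\<dots> \<le> (1 + 1 / \<epsilon>) * S * (R + \<epsilon>) ^ n"
      proof (intro mult_right_mono mult_left_mono)
        show "\<bar>t 0\<bar> + \<bar>t 1\<bar> \<le> S"
          using coord_le_norm[OF e, of "x 0 - z"] coord_le_norm[OF e, of "x 1 - z"] by (simp add: t_def S_def)
        show "0 \<le> (R + \<epsilon>) ^ n" "0 \<le> 1 + 1 / \<epsilon>" using \<epsilon> \<beta> by (auto simp: R_def nag_rate_def)
      qed
      finally show ?thesis by (simp add: t_def)
    qed
    have "norm (x n - z) \<le> (\<Sum>e\<in>B. \<bar>(x n - z) \<bullet> e\<bar>)" by (rule norm_le_sum_coord)
    also have "\<dots> \<le> (\<Sum>e\<in>B. (1 + 1 / \<epsilon>) * S * (R + \<epsilon>) ^ n)" by (rule sum_mono) (rule coord)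
    also have "\<dots> = (C - 1) * S * (R + \<epsilon>) ^ n" by (simp add: C_def)
    also have "\<dots> \<le> C * S * (R + \<epsilon>) ^ n"
      using \<epsilon> \<beta> by (intro mult_right_mono) (auto simp: S_def R_def nag_rate_def)
    finally show "norm (nag q \<alpha> \<beta> x0 x1 n - z) \<le> C * (norm (nag q \<alpha> \<beta> x0 x1 1 - z)
        + norm (nag q \<alpha> \<beta> x0 x1 0 - z)) * (R + \<epsilon>) ^ n"
      by (simp only: x_def S_def)
  qed
  then show "\<exists>C>0. \<forall>x0 x1 z. (\<forall>y. q z \<le> q y) \<longrightarrow>
      linear_bound (nag q \<alpha> \<beta> x0 x1) z C (nag_rate \<mu> L \<alpha> \<beta> + \<epsilon>)"
    using C unfolding R_def by blast
qed

text \<open>Conversely, started on an eigenvector line NAG reproduces every solution of the mode's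
  recurrence, so a contraction factor dominates the radii of all modes.\<close>

lemma mode_radius_le_contraction_factor:
  fixes A :: "real ^ 'n ^ 'n"
  assumes factor: "nag_contraction_factor (quadratic_problems \<mu> L :: (real ^ 'n \<Rightarrow> real) set) \<alpha> \<beta> r"
    and A: "transpose A = A" "0 < \<mu>" "Min (eigenvalues A) = \<mu>" "Max (eigenvalues A) = L"
    and l: "l \<in> eigenvalues A" and \<epsilon>: "0 < \<epsilon>"
  shows "mode_radius \<beta> (1 - \<alpha> * l) \<le> r + \<epsilon>"
proof -
  obtain B ev where "eigenbasis ((*v) A) B ev" using symmetric_matrix_eigenbasis[OF A(1)] .
  then interpret eigenbasis "(*v) A" B ev .
  have E: "eigenvalues A = ev ` B" by (rule eigenvalues_eigenbasis) unfold_locales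
  obtain e where e: "e \<in> B" "l = ev e" using l unfolding E by blast
  have ev0: "0 \<le> ev b" if "b \<in> B" for b
  proof -
    have "\<mu> \<le> ev b" using A(3)[symmetric] that finite unfolding E by simp
    then show ?thesis using A(2) by simp
  qed
  define q where "q = (\<lambda>x. 1/2 * (x \<bullet> (A *v x)) + 0 \<bullet> x + (0::real))"
  have "q \<in> quadratic_problems \<mu> L"
    unfolding quadratic_problems_def q_def using A by blast
  then obtain C where C: "\<And>x0 x1 z. (\<forall>y. q z \<le> q y) \<Longrightarrow> linear_bound (nag q \<alpha> \<beta> x0 x1) z C (r + \<epsilon>)"
    using factor \<epsilon> unfolding nag_contraction_factor_def by blast
  have r: "0 \<le> r" using factor by (simp add: nag_contraction_factor_def)
  have grad: "gradient q x = A *v x" for x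
    using gradient_eqI[OF quadratic_GDERIV[OF A(1), of 0 0 x]] by (simp add: q_def)
  have min: "\<forall>y. q 0 \<le> q y"
    unfolding q_def quadratic_form by (simp add: ev0 sum_nonneg)
  have "root_radius ((1 + \<beta>) * (1 - \<alpha> * l)) (\<beta> * (1 - \<alpha> * l)) \<le> r + \<epsilon>"
  proof (rule root_radius_le_rate)
    show "0 < r + \<epsilon>" using r \<epsilon> by simp
    fix t :: "nat \<Rightarrow> real" and n :: nat
    assume rec: "\<And>n. t (Suc (Suc n)) = (1 + \<beta>) * (1 - \<alpha> * l) * t (Suc n) - \<beta> * (1 - \<alpha> * l) * t n"
      and n: "1 \<le> n"
    define x where "x = nag q \<alpha> \<beta> (t 0 *\<^sub>R e) (t 1 *\<^sub>R e)"
    have "x n = t n *\<^sub>R e \<and> x (Suc n) = t (Suc n) *\<^sub>R e" for n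
    proof (induction n)
      case 0
      show ?case by (simp add: x_def)
    next
      case (Suc n)
      define d where "d = t (Suc n) + \<beta> * (t (Suc n) - t n)"
      define y where "y = x (Suc n) + \<beta> *\<^sub>R (x (Suc n) - x n)"
      have y: "y = d *\<^sub>R e" using Suc by (simp add: y_def d_def algebra_simps)
      have "x (Suc (Suc n)) = y - \<alpha> *\<^sub>R gradient q y" by (simp add: x_def y_def Let_def)
      also have "\<dots> = (d - \<alpha> * (l * d)) *\<^sub>R e"
        using eigenvector[OF e(1)] unfolding grad y
        by (simp add: e(2) matrix_vector_mult_scaleR algebra_simps)
      also have "d - \<alpha> * (l * d) = t (Suc (Suc n))" unfolding rec d_def by (simp add: algebra_simps)
      finally show ?case using Suc by simp
    qed
    then have xt: "x n = t n *\<^sub>R e" for n by blast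
    have "norm (x n - 0) \<le> C * (norm (x 1 - 0) + norm (x 0 - 0)) * (r + \<epsilon>) ^ n"
      using C[OF min] n unfolding linear_bound_def x_def by blast
    then show "\<bar>t n\<bar> \<le> C * (\<bar>t 1\<bar> + \<bar>t 0\<bar>) * (r + \<epsilon>) ^ n"
      by (simp add: xt norm_basis[OF e(1)])
  qed
  then show ?thesis by (simp add: mode_radius_def)
qed

lemma optimal_nag_contraction_factor_quadratic:
  fixes A :: "real ^ 'n ^ 'n"
  assumes \<mu>: "0 < \<mu>" "\<mu> \<le> L"
    and A: "transpose A = A" "Min (eigenvalues A) = \<mu>" "Max (eigenvalues A) = L"
    and mem: "\<mu> \<in> eigenvalues A" "L \<in> eigenvalues A"
  shows "optimal_nag_contraction_factor (quadratic_problems \<mu> L :: (real ^ 'n \<Rightarrow> real) set)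
    (4 / (3 * L + \<mu>)) ((sqrt (3 * L + \<mu>) - 2 * sqrt \<mu>) / (sqrt (3 * L + \<mu>) + 2 * sqrt \<mu>))
    ((sqrt (3 * L + \<mu>) - 2 * sqrt \<mu>) / sqrt (3 * L + \<mu>))"
    (is "optimal_nag_contraction_factor ?Q ?\<alpha> ?\<beta> ?r")
proof -
  note range = optimal_parameters_range[OF \<mu>]
  have rate: "nag_rate \<mu> L ?\<alpha> ?\<beta> = ?r" by (rule nag_rate_optimal[OF \<mu>])
  have "nag_contraction_factor ?Q ?\<alpha> ?\<beta> (nag_rate \<mu> L ?\<alpha> ?\<beta>)"
    by (rule nag_contraction_factor_quadratic) (use range rate in simp_all)
  moreover have "?r \<le> r'"
    if \<alpha>': "0 < \<alpha>'" and \<beta>': "\<beta>' \<in> {0..<1}" and factor: "nag_contraction_factor ?Q \<alpha>' \<beta>' r'" for \<alpha>' \<beta>' r'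
  proof (rule field_le_epsilon)
    fix \<epsilon> :: real assume \<epsilon>: "0 < \<epsilon>"
    have "0 \<le> r'" using factor by (simp add: nag_contraction_factor_def)
    then show "?r \<le> r' + \<epsilon>"
      using \<alpha>' \<beta>' \<mu> \<epsilon> by (intro optimal_rate_le_radius[of \<alpha>' \<beta>']
          mode_radius_le_contraction_factor[OF factor A(1) \<mu>(1) A(2,3) _ \<epsilon>] mem) simp_all
  qed
  ultimately show ?thesis
    unfolding optimal_nag_contraction_factor_def using range unfolding rate by simp
qed

text \<open>If \<open>H\<close> is positive semidefinite and \<open>\<mu>\<close> is its smallest nonzero eigenvalue, this only replaces
  the eigenvalue 0 by \<open>\<mu>\<close>. It supplies a strongly convex quadratic problem with the extreme
  eigenvalues \<open>\<mu>\<close> and \<open>L\<close> in the given dimension.\<close>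

lemma matrix_with_raised_eigenvalues:
  fixes H :: "real ^ 'n ^ 'n"
  assumes "eigenbasis ((*v) H) B ev"
  obtains A :: "real ^ 'n ^ 'n" where "transpose A = A" "eigenvalues A = (\<lambda>b. max (ev b) \<mu>) ` B"
proof -
  interpret eigenbasis "(*v) H" B ev by fact
  define l where "l b = max (ev b) \<mu>" for b
  define F where "F x = (\<Sum>b\<in>B. (l b * (x \<bullet> b)) *\<^sub>R b)" for x
  have lin: "linear F"
    unfolding F_def by (rule linearI)
      (simp_all add: inner_add_left distrib_left scaleR_add_left sum.distrib scaleR_sum_right mult.left_commute)
  have sa: "F x \<bullet> y = x \<bullet> F y" for x y
    by (simp add: F_def inner_sum_left inner_sum_right mult.commute mult.left_commute inner_commute)
  have AF: "(*v) (matrix F) = F" using lin by (rule matrix_vector_mul(2))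
  have coordF: "F x \<bullet> c = l c * (x \<bullet> c)" if "c \<in> B" for x c
    unfolding F_def by (rule coord_sum[OF that])
  have "F b = l b *\<^sub>R b" if "b \<in> B" for b
    by (rule eq_if_coords_eq) (simp add: coordF orthonormal that)
  then have "eigenbasis F B l"
    by (intro eigenbasis.intro[OF lin sa finite orthonormal complete])
  then have "eigenvalues (matrix F) = l ` B" by (intro eigenvalues_eigenbasis) (simp add: AF)
  moreover have "transpose (matrix F) = matrix F"
    by (rule self_adjoint_matrix_symmetric) (simp add: AF sa)
  ultimately show thesis using that[of "matrix F"] unfolding l_def by blast
qed

section \<open>NAG under the local PL condition\<close>

theorem theorem2p2:
  fixes f :: "real ^ 'n \<Rightarrow> real" and xs :: "real ^ 'n" and S :: "(real ^ 'n) set"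
    and L \<mu> \<alpha>_opt \<beta>_opt r_opt :: real
  assumes C2: "twice_continuously_differentiable f"
    and bounded_below: "bdd_below (range f)"
    and minimizer: "local_minimizer f xs"
    and PL: "local_PL f xs"
    and nonconstant: "\<not> (\<exists>V. open V \<and> xs \<in> V \<and> (\<forall>y\<in>V. f y = f xs))"
    and L: "L = Max (eigenvalues (hessian f xs))"
    and \<mu>: "\<mu> = Min (eigenvalues (hessian f xs) - {0})"
    and S: "S = {x. local_minimizer f x \<and> f x = f xs}"
    and \<alpha>_opt: "\<alpha>_opt = 4 / (3 * L + \<mu>)"
    and \<beta>_opt: "\<beta>_opt = (sqrt (3 * L + \<mu>) - 2 * sqrt \<mu>) / (sqrt (3 * L + \<mu>) + 2 * sqrt \<mu>)"
    and r_opt: "r_opt = (sqrt (3 * L + \<mu>) - 2 * sqrt \<mu>) / sqrt (3 * L + \<mu>)"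
  shows
    "(\<exists>\<rho> :: real \<Rightarrow> real \<Rightarrow> real.
        (\<forall>\<beta>\<in>{0..<1}. \<forall>\<alpha>\<in>{0<..<2 * (\<beta> + 1) / (L * (2 * \<beta> + 1))}. \<rho> \<alpha> \<beta> \<in> {0<..<1}) \<and>
        (\<mu> < L \<longrightarrow> \<rho> \<alpha>_opt \<beta>_opt = r_opt) \<and>
        (\<exists>\<epsilon>0>0. \<forall>\<epsilon>\<in>{0<..<\<epsilon>0}. \<exists>U C. open U \<and> xs \<in> U \<and> C > 0 \<and>
          (\<forall>x0\<in>U. \<forall>x1\<in>U.
            (\<forall>\<beta>\<in>{0..<1}. \<forall>\<alpha>\<in>{0<..<2 * (\<beta> + 1) / ((L + \<epsilon>) * (2 * \<beta> + 1))}.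
               \<rho> \<alpha> \<beta> + \<epsilon> < 1 \<longrightarrow>
               (\<exists>xs'\<in>S. linear_bound (nag f \<alpha> \<beta> x0 x1) xs' C (\<rho> \<alpha> \<beta> + \<epsilon>))) \<and>
            (\<alpha>_opt \<in> {0<..<2 * (\<beta>_opt + 1) / ((L + \<epsilon>) * (2 * \<beta>_opt + 1))} \<and>
             r_opt + \<epsilon> < 1 \<and>
             (\<exists>xs'\<in>S. linear_bound (nag f \<alpha>_opt \<beta>_opt x0 x1) xs' C (r_opt + \<epsilon>)))))) \<and>
     optimal_nag_contraction_factor
       (quadratic_problems \<mu> L :: (real ^ 'n \<Rightarrow> real) set) \<alpha>_opt \<beta>_opt r_opt"
proof -
  define H where "H = hessian f xs"
  note D = twice_continuously_differentiableD[OF C2]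
  obtain B ev where eb: "eigenbasis ((*v) H) B ev"
    using eigenbasis_exists[OF matrix_vector_mul_linear gradient_derivative_self_adjoint[OF D(1,2)]]
    unfolding H_def by blast
  obtain V1 where V1: "open V1" "xs \<in> V1" "\<forall>y\<in>V1. f xs \<le> f y"
    using minimizer unfolding local_minimizer_def by blast
  obtain V2 \<nu> where V2: "open V2" "xs \<in> V2" "0 < \<nu>"
    "\<forall>y\<in>V2. (norm (gradient f y))\<^sup>2 \<ge> 2 * \<nu> * (f y - f xs)"
    using PL unfolding local_PL_def by blast
  interpret local_PL_minimum f xs B ev "V1 \<inter> V2" \<nu>
    by (intro local_PL_minimum.intro local_PL_minimum_axioms.intro eb[unfolded H_def] C2)
      (use V1 V2 in auto)
  have fin: "finite (ev ` B)" using finite by (rule finite_imageI)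
  have E: "eigenvalues (hessian f xs) = ev ` B" by (rule eigenvalues_eigenbasis) unfold_locales
  have "ev ` B - {0} \<noteq> {}"
    using locally_constant_if_hessian_zero nonconstant by blast
  then have "\<mu> \<in> ev ` B - {0}" unfolding \<mu> E using fin by (intro Min_in) auto
  then obtain b\<mu> where b\<mu>: "b\<mu> \<in> B" "ev b\<mu> = \<mu>" and "\<mu> \<noteq> 0" by auto
  then have \<mu>0: "0 < \<mu>" using eigenvalue_nonneg[of b\<mu>] by simp
  have le_L: "ev b \<le> L" if "b \<in> B" for b unfolding L E using fin that by (intro Max_ge) auto
  have \<mu>L: "\<mu> \<le> L" using le_L[OF b\<mu>(1)] b\<mu>(2) by simp
  have "L \<in> ev ` B" unfolding L E using fin b\<mu> by (intro Max_in) auto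
  then obtain bL where bL: "bL \<in> B" "ev bL = L" by auto
  have spec: "ev b = 0 \<or> \<mu> \<le> ev b \<and> ev b \<le> L" if "b \<in> B" for b
  proof (cases "ev b = 0")
    case False
    then have "\<mu> \<le> ev b" unfolding \<mu> E using fin that by (intro Min_le) auto
    then show ?thesis using le_L[OF that] by simp
  qed simp
  have L0: "0 < L" using \<mu>0 \<mu>L by simp
  have range: "0 < \<alpha>_opt" "0 \<le> \<beta>_opt" "\<beta>_opt < 1" "0 \<le> r_opt" "r_opt < 1"
    unfolding \<alpha>_opt \<beta>_opt r_opt by (fact optimal_parameters_range[OF \<mu>0 \<mu>L])+
  have rate_opt: "nag_rate \<mu> L \<alpha>_opt \<beta>_opt = r_opt"
    unfolding \<alpha>_opt \<beta>_opt r_opt by (rule nag_rate_optimal[OF \<mu>0 \<mu>L])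
  have r_opt_pos: "0 < r_opt" if "\<mu> < L"
  proof -
    have "sqrt (4 * \<mu>) < sqrt (3 * L + \<mu>)" using that by (intro real_sqrt_less_mono) simp
    then show ?thesis using \<mu>0 L0 by (simp add: r_opt real_sqrt_mult)
  qed

  \<comment> \<open>The rate vanishes only if \<open>\<mu> = L\<close>, \<open>\<beta> = 0\<close> and \<open>\<alpha> = 1 / L\<close>; there any value in (0,1) serves.\<close>
  define \<rho> where "\<rho> \<alpha> \<beta> = (if nag_rate \<mu> L \<alpha> \<beta> = 0 then 1 / 2 else nag_rate \<mu> L \<alpha> \<beta>)" for \<alpha> \<beta>
  have rate_nonneg: "0 \<le> nag_rate \<mu> L \<alpha> \<beta>" if "0 \<le> \<beta>" for \<alpha> \<beta> using that by (simp add: nag_rate_def)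
  have rate_le: "nag_rate \<mu> L \<alpha> \<beta> \<le> \<rho> \<alpha> \<beta>" for \<alpha> \<beta> by (simp add: \<rho>_def)
  have \<rho>_range: "\<rho> \<alpha> \<beta> \<in> {0<..<1}"
    if "\<beta> \<in> {0..<1}" "\<alpha> \<in> {0<..<2 * (\<beta> + 1) / (L * (2 * \<beta> + 1))}" for \<alpha> \<beta>
    using nag_rate_less_one[of \<beta> \<mu> L \<alpha>] rate_nonneg[of \<beta> \<alpha>] that \<mu>0 \<mu>L by (auto simp: \<rho>_def)
  have \<rho>_opt: "\<rho> \<alpha>_opt \<beta>_opt = r_opt" if "\<mu> < L"
    using r_opt_pos[OF that] by (simp add: \<rho>_def rate_opt)

  \<comment> \<open>The slack in the step size condition at the optimal parameters limits \<open>\<epsilon>\<close>.\<close>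
  define gap where "gap = 2 * (\<beta>_opt + 1) - \<alpha>_opt * L * (2 * \<beta>_opt + 1)"
  have gap: "0 < gap"
  proof -
    have "(L - \<mu>) * (2 * \<beta>_opt + 1) \<le> (L - \<mu>) * 3" using range \<mu>L by (intro mult_left_mono) auto
    also have "\<dots> < 3 * L + \<mu>" using \<mu>0 by simp
    finally have "(L - \<mu>) * (2 * \<beta>_opt + 1) < 3 * L + \<mu>" .
    moreover have "(3 * L + \<mu>) * gap = (3 * L + \<mu>) - (L - \<mu>) * (2 * \<beta>_opt + 1)"
    proof -
      have "3 * L + \<mu> \<noteq> 0" using \<mu>0 L0 by linarith
      then have "(3 * L + \<mu>) * \<alpha>_opt = 4"
        unfolding \<alpha>_opt times_divide_eq_right by (rule nonzero_mult_div_cancel_left)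
      then have "(3 * L + \<mu>) * gap = (3 * L + \<mu>) * (2 * (\<beta>_opt + 1)) - 4 * L * (2 * \<beta>_opt + 1)"
        unfolding gap_def right_diff_distrib mult.assoc[symmetric] by simp
      then show ?thesis by (simp add: algebra_simps)
    qed
    ultimately have "0 < (3 * L + \<mu>) * gap" by simp
    then show ?thesis using \<mu>0 L0 by (simp add: zero_less_mult_iff)
  qed
  define \<epsilon>0 where "\<epsilon>0 = min (1 - r_opt) (gap / (\<alpha>_opt * (2 * \<beta>_opt + 1)))"
  have \<epsilon>0: "0 < \<epsilon>0" using range gap by (simp add: \<epsilon>0_def)

  have local: "\<exists>U C. open U \<and> xs \<in> U \<and> C > 0 \<and>
          (\<forall>x0\<in>U. \<forall>x1\<in>U.
            (\<forall>\<beta>\<in>{0..<1}. \<forall>\<alpha>\<in>{0<..<2 * (\<beta> + 1) / ((L + \<epsilon>) * (2 * \<beta> + 1))}.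
               \<rho> \<alpha> \<beta> + \<epsilon> < 1 \<longrightarrow>
               (\<exists>xs'\<in>S. linear_bound (nag f \<alpha> \<beta> x0 x1) xs' C (\<rho> \<alpha> \<beta> + \<epsilon>))) \<and>
            (\<alpha>_opt \<in> {0<..<2 * (\<beta>_opt + 1) / ((L + \<epsilon>) * (2 * \<beta>_opt + 1))} \<and>
             r_opt + \<epsilon> < 1 \<and>
             (\<exists>xs'\<in>S. linear_bound (nag f \<alpha>_opt \<beta>_opt x0 x1) xs' C (r_opt + \<epsilon>))))"
    if \<epsilon>_range: "\<epsilon> \<in> {0<..<\<epsilon>0}" for \<epsilon>
  proof -
    have \<epsilon>: "0 < \<epsilon>" and \<epsilon>1: "r_opt + \<epsilon> < 1" and \<epsilon>2: "\<epsilon> < gap / (\<alpha>_opt * (2 * \<beta>_opt + 1))"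
      using \<epsilon>_range by (auto simp: \<epsilon>0_def)
    obtain U C where U: "open U" "xs \<in> U" "0 < C" and conv:
      "\<And>x0 x1 \<alpha> \<beta>. \<lbrakk>x0 \<in> U; x1 \<in> U; 0 < \<alpha>; \<alpha> * L \<le> 2; 0 \<le> \<beta>; \<beta> < 1; nag_rate \<mu> L \<alpha> \<beta> + \<epsilon> \<le> 1\<rbrakk> \<Longrightarrow>
        \<exists>x'. local_minimizer f x' \<and> f x' = f xs \<and>
          linear_bound (nag f \<alpha> \<beta> x0 x1) x' C (nag_rate \<mu> L \<alpha> \<beta> + \<epsilon>)"
      by (rule nag_local_linear_convergence[OF \<mu>0 \<mu>L \<epsilon> spec]) (assumption | rule that)+
    have step: "\<alpha> * L \<le> 2"
      if "\<alpha> \<in> {0<..<2 * (\<beta> + 1) / ((L + \<epsilon>) * (2 * \<beta> + 1))}" "0 \<le> \<beta>" for \<alpha> \<beta>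
    proof -
      have pos: "0 < 2 * \<beta> + 1" using that(2) by simp
      have "0 < (L + \<epsilon>) * (2 * \<beta> + 1)" using L0 \<epsilon> pos by simp
      then have "\<alpha> * ((L + \<epsilon>) * (2 * \<beta> + 1)) < 2 * (\<beta> + 1)" using that(1) by (simp add: pos_less_divide_eq)
      moreover have "\<alpha> * (L * (2 * \<beta> + 1)) \<le> \<alpha> * ((L + \<epsilon>) * (2 * \<beta> + 1))"
        using that \<epsilon> pos by (intro mult_left_mono mult_right_mono) auto
      ultimately have "(\<alpha> * L) * (2 * \<beta> + 1) \<le> 2 * (2 * \<beta> + 1)" using that(2) by (simp add: algebra_simps)
      then show ?thesis using pos by (rule mult_right_le_imp_le)
    qed
    have opt_step: "\<alpha>_opt \<in> {0<..<2 * (\<beta>_opt + 1) / ((L + \<epsilon>) * (2 * \<beta>_opt + 1))}"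
    proof -
      have pos: "0 < \<alpha>_opt * (2 * \<beta>_opt + 1)" "0 < (L + \<epsilon>) * (2 * \<beta>_opt + 1)"
        using range L0 \<epsilon> by simp_all
      have "\<epsilon> * (\<alpha>_opt * (2 * \<beta>_opt + 1)) < gap" using \<epsilon>2 pos by (simp only: pos_less_divide_eq)
      then have "\<alpha>_opt * ((L + \<epsilon>) * (2 * \<beta>_opt + 1)) < 2 * (\<beta>_opt + 1)"
        unfolding gap_def by (simp add: algebra_simps)
      then have "\<alpha>_opt < 2 * (\<beta>_opt + 1) / ((L + \<epsilon>) * (2 * \<beta>_opt + 1))"
        using pos(2) by (simp only: pos_less_divide_eq)
      then show ?thesis using range by simp
    qed
    have 1: "\<exists>xs'\<in>S. linear_bound (nag f \<alpha> \<beta> x0 x1) xs' C (\<rho> \<alpha> \<beta> + \<epsilon>)"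
      if x: "x0 \<in> U" "x1 \<in> U" and \<beta>01: "\<beta> \<in> {0..<1}" and \<alpha>: "\<alpha> \<in> {0<..<2 * (\<beta> + 1) / ((L + \<epsilon>) * (2 * \<beta> + 1))}"
        and rate: "\<rho> \<alpha> \<beta> + \<epsilon> < 1" for x0 x1 \<alpha> \<beta>
    proof -
      have \<beta>: "0 \<le> \<beta>" "\<beta> < 1" using \<beta>01 by auto
      have "nag_rate \<mu> L \<alpha> \<beta> + \<epsilon> \<le> 1" using rate rate_le[of \<alpha> \<beta>] by linarith
      moreover have "0 < \<alpha>" using \<alpha> by simp
      ultimately have "\<exists>x'. local_minimizer f x' \<and> f x' = f xs \<and>
          linear_bound (nag f \<alpha> \<beta> x0 x1) x' C (nag_rate \<mu> L \<alpha> \<beta> + \<epsilon>)"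
        by (intro conv x step[OF \<alpha> \<beta>(1)] \<beta>)
      then obtain x' where x': "local_minimizer f x'" "f x' = f xs"
        "linear_bound (nag f \<alpha> \<beta> x0 x1) x' C (nag_rate \<mu> L \<alpha> \<beta> + \<epsilon>)"
        by blast
      have "linear_bound (nag f \<alpha> \<beta> x0 x1) x' C (\<rho> \<alpha> \<beta> + \<epsilon>)"
        by (rule linear_bound_mono[OF x'(3)])
          (use rate_nonneg[OF \<beta>(1), of \<alpha>] rate_le[of \<alpha> \<beta>] \<epsilon> U(3) in simp_all)
      then show ?thesis using x' unfolding S by blast
    qed
    have 2: "\<exists>xs'\<in>S. linear_bound (nag f \<alpha>_opt \<beta>_opt x0 x1) xs' C (r_opt + \<epsilon>)"
      if x: "x0 \<in> U" "x1 \<in> U" for x0 x1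
    proof -
      have "nag_rate \<mu> L \<alpha>_opt \<beta>_opt + \<epsilon> \<le> 1" using \<epsilon>1 rate_opt by simp
      then have "\<exists>x'. local_minimizer f x' \<and> f x' = f xs \<and>
          linear_bound (nag f \<alpha>_opt \<beta>_opt x0 x1) x' C (nag_rate \<mu> L \<alpha>_opt \<beta>_opt + \<epsilon>)"
        by (intro conv x step[OF opt_step range(2)] range)
      then obtain x' where "local_minimizer f x'" "f x' = f xs"
        "linear_bound (nag f \<alpha>_opt \<beta>_opt x0 x1) x' C (nag_rate \<mu> L \<alpha>_opt \<beta>_opt + \<epsilon>)"
        by blast
      then show ?thesis unfolding S rate_opt by blast
    qed
    show ?thesis
      by (intro exI[of _ U] exI[of _ C] conjI ballI impI U 1 2 opt_step \<epsilon>1)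
  qed

  obtain A :: "real ^ 'n ^ 'n" where A: "transpose A = A" "eigenvalues A = (\<lambda>b. max (ev b) \<mu>) ` B"
    using matrix_with_raised_eigenvalues[OF eb] by blast
  have finA: "finite (eigenvalues A)" unfolding A(2) using finite by (rule finite_imageI)
  have mem: "\<mu> \<in> eigenvalues A" "L \<in> eigenvalues A"
    unfolding A(2) using b\<mu> bL \<mu>L by (auto intro: rev_image_eqI)
  have bounds: "\<mu> \<le> l \<and> l \<le> L" if "l \<in> eigenvalues A" for l
    using that le_L \<mu>L unfolding A(2) by auto
  have "Min (eigenvalues A) = \<mu>" using finA mem bounds by (intro Min_eqI) auto
  moreover have "Max (eigenvalues A) = L" using finA mem bounds by (intro Max_eqI) auto
  ultimately have optimal: "optimal_nag_contraction_factor
      (quadratic_problems \<mu> L :: (real ^ 'n \<Rightarrow> real) set) \<alpha>_opt \<beta>_opt r_opt"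
    unfolding \<alpha>_opt \<beta>_opt r_opt by (intro optimal_nag_contraction_factor_quadratic[OF \<mu>0 \<mu>L A(1)] mem)
  show ?thesis
    by (intro conjI exI[of _ \<rho>] exI[of _ \<epsilon>0] ballI impI \<rho>_range \<rho>_opt \<epsilon>0 local optimal)
qed

end
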